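(* Let $n\ge 1$ be an integer, $p$ a prime and $k\ge 1$ an integer. Let $f:(\mathbb{Z}/p^k\mathbb{Z})^n\to\mathbb{Z}_{\ge 0}$ be a function that is not identically zero, and put $w=\max_{u\in\mathbb{P}(\mathbb{Z}/p^k\mathbb{Z})^{n-1}} f^*(u)$. (i) If $(w,n)\neq(1,1)$, then $$\sum_{x\in(\mathbb{Z}/p^k\mathbb{Z})^n} |f(x)|^n\ \ge\ \frac{C_{p^k,n}}{|\mathbb{P}(\mathbb{Z}/p^k\mathbb{Z})^{n-1}|}\sum_{u\in\mathbb{P}(\mathbb{Z}/p^k\mathbb{Z})^{n-1}}|f^*(u)|^n$$ with $$C_{p^k,n}=\frac{1}{\left(2\left\lceil\log_p(w)+\log_p(n)\right\rceil\right)^n}.$$ (ii) If $p>n$, the same inequality holds with $$C_{p^k,n}=\left(\lceil\log_p(w)\rceil+1\right)^{-n}\left(1+\frac{n}{p}\right)^{-n}.$$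
   Context: The projective space $\mathbb{P}(\mathbb{Z}/p^k\mathbb{Z})^{n-1}$ consists of the vectors $u\in(\mathbb{Z}/p^k\mathbb{Z})^n$ having at least one coordinate that is a unit, taken up to multiplication by units in $(\mathbb{Z}/p^k\mathbb{Z})^\times$; one representative in $(\mathbb{Z}/p^k\mathbb{Z})^n$ is fixed for each element. For $f:(\mathbb{Z}/p^k\mathbb{Z})^n\to\mathbb{Z}_{\ge0}$ the maximal function $f^*:\mathbb{P}(\mathbb{Z}/p^k\mathbb{Z})^{n-1}\to\mathbb{Z}_{\ge0}$ is $$f^*(u)=\sup_{a\in(\mathbb{Z}/p^k\mathbb{Z})^n}\ \sum_{t\in\mathbb{Z}/p^k\mathbb{Z}}f(a+tu).$$ *)

theory Defs
  imports "HOL-Analysis.Analysis"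
    "Berlekamp_Zassenhaus.Finite_Field"
begin

text \<open>
  The type \<open>'a mod_ring\<close> is the ring of integers modulo \<open>CARD('a)\<close>, so under the hypotheses
  \<open>CARD('a) = p ^ k\<close> and \<open>CARD('n) = n\<close> the type \<open>'a mod_ring ^ 'n\<close> is the module of
  \<open>n\<close>-dimensional vectors over the integers modulo \<open>p ^ k\<close>.
\<close>

definition unimodular_vectors :: "('a::comm_ring_1 ^ 'n) set" where
  "unimodular_vectors = {u. \<exists>i. u $ i dvd 1}"

definition unit_multiple_rel :: "(('a::comm_ring_1 ^ 'n) \<times> ('a ^ 'n)) set" where
  "unit_multiple_rel =
     {(u, v). u \<in> unimodular_vectors \<and> v \<in> unimodular_vectors \<and> (\<exists>c. c dvd 1 \<and> v = c *s u)}"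

definition proj_space :: "('a::comm_ring_1 ^ 'n) set set" where
  "proj_space = unimodular_vectors // unit_multiple_rel"

text \<open>A choice of one representative vector for each point of projective space.\<close>

definition proj_representatives :: "(('a::comm_ring_1 ^ 'n) set \<Rightarrow> 'a ^ 'n) \<Rightarrow> bool" where
  "proj_representatives rep \<longleftrightarrow> (\<forall>P\<in>proj_space. rep P \<in> P)"

text \<open>
  The supremum is taken in \<open>nat\<close>; it ranges over a finite nonempty set because the ring is finite.
\<close>

definition maximal_function ::
  "(('a::{finite,comm_ring_1} ^ 'n) set \<Rightarrow> 'a ^ 'n) \<Rightarrow> ('a ^ 'n \<Rightarrow> nat) \<Rightarrow> ('a ^ 'n) set \<Rightarrow> nat" where
  "maximal_function rep f P = (SUP a. \<Sum>t\<in>UNIV. f (a + t *s rep P))"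

lemma equiv_unit_multiple_rel:
  "equiv (unimodular_vectors :: ('a::comm_ring_1 ^ 'n) set) unit_multiple_rel"
proof (rule equivI)
  show "unit_multiple_rel \<subseteq> unimodular_vectors \<times> (unimodular_vectors :: ('a ^ 'n) set)"
    by (auto simp: unit_multiple_rel_def)
  show "refl_on unimodular_vectors (unit_multiple_rel :: (('a ^ 'n) \<times> ('a ^ 'n)) set)"
    by (auto simp: refl_on_def unit_multiple_rel_def intro!: exI[of _ 1])
  show "sym (unit_multiple_rel :: (('a ^ 'n) \<times> ('a ^ 'n)) set)"
  proof (rule symI)
    fix u v :: "'a ^ 'n"
    assume uv: "(u, v) \<in> unit_multiple_rel"
    then obtain c where c: "c dvd 1" "v = c *s u"
      by (auto simp: unit_multiple_rel_def)
    from c(1) obtain d where d: "1 = c * d" by (auto simp: dvd_def)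
    have "u = d *s v" using d c(2) by (simp add: vector_smult_assoc mult.commute)
    moreover have "d dvd 1" using d by (metis dvd_triv_right)
    ultimately show "(v, u) \<in> unit_multiple_rel"
      using uv by (auto simp: unit_multiple_rel_def)
  qed
  show "trans (unit_multiple_rel :: (('a ^ 'n) \<times> ('a ^ 'n)) set)"
  proof (rule transI)
    fix u v w :: "'a ^ 'n"
    assume uv: "(u, v) \<in> unit_multiple_rel" and vw: "(v, w) \<in> unit_multiple_rel"
    then obtain c d where "c dvd 1" "v = c *s u" "d dvd 1" "w = d *s v"
      by (auto simp: unit_multiple_rel_def)
    then have "d * c dvd 1" "w = (d * c) *s u"
      using mult_dvd_mono[of d 1 c 1] by (auto simp: vector_smult_assoc)
    with uv vw show "(u, w) \<in> unit_multiple_rel"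
      by (auto simp: unit_multiple_rel_def)
  qed
qed

end

theory Submission
  imports Defs
    "Jordan_Normal_Form.Determinant"
begin

text \<open>
  The proof is the polynomial method with multiplicities, in the form that Arsovski and Dhar gave it
  for prime power moduli. Let \<open>\<zeta>\<close> be a primitive root of unity of order \<open>p ^ k\<close>. A complex
  polynomial vanishing at every \<open>\<zeta> ^ x\<close> to order \<open>m * f x\<close> vanishes to order \<open>m * f\<^sup>*(u)\<close>
  along the curve \<open>\<zeta> ^ a * z ^ u\<close> for a suitable \<open>a\<close>, and modulo the prime above \<open>p\<close> all of
  these zeros merge at \<open>z = 1\<close>. So the number of conditions at the points, about
  \<open>m ^ n * (\<Sum>x. f x ^ n) / n!\<close>, is at least the rank modulo \<open>p\<close> of the jets along the
  directions \<open>u\<close>. Interpolation at nodes whose exponents are prime to \<open>p\<close> shows that, modulo \<open>p\<close>,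
  a polynomial of degree less than \<open>s / (1 + l)\<close> is determined by its jets of weighted level below
  \<open>s\<close>, where a derivative transversal to the curve has weight \<open>p ^ l\<close>. This yields a triangular
  family of jets; averaging it over the linear automorphisms and letting \<open>m\<close> tend to infinity gives
  the inequality with constant \<open>(1 + l) ^ -n\<close>, where \<open>l = \<lceil>log\<^sub>p w\<rceil>\<close>. Both stated constants are
  at most this one.
\<close>

text \<open>The factor \<open>1 + l\<close> is the price of interpolation. The nodes
  \<open>(1 + \<tau>) ^ u\<close> all meet at \<open>\<tau> = 0\<close>, and modulo \<open>p\<close>
  two of them separate only at order \<open>p ^ v\<close>, where \<open>v\<close> is the p-adic
  valuation of the difference of their exponents. Summed over the \<open>j\<close> other nodes of a
  grid, each p-adic digit adds at most \<open>j\<close> to this order, so the total would grow with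
  the number of digits. Displacing the nodes at order \<open>p ^ l\<close> stops the growth after
  \<open>l\<close> digits, at \<open>(1 + l) * j\<close>, but brings in derivatives transversal to
  the curve. They are affordable: each lowers the vanishing order by one at those points of the line
  where \<open>f\<close> is nonzero, and as values of \<open>f\<close> are integers there are at
  most \<open>w \<le> p ^ l\<close> such points. Which directions occur in the family is not
  controlled, whence the averaging. The two characteristics meet in a determinant over
  \<open>int poly\<close>: with too few conditions it vanishes at all primitive roots of unity, so
  \<open>p\<close> divides its value at \<open>1\<close>, which is a product of integers prime to
  \<open>p\<close>.\<close>

hide_const (open) up_ring.monom up_ring.coeff module.smult

subsection \<open>Linear systems and roots of unity\<close>

text \<open>Elimination by cross multiplication with the pivot \<open>A e j\<close> needs no
  division, so it works over any integral domain.\<close>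

lemma underdetermined_system_solvable:
  fixes A :: "'i \<Rightarrow> 'k \<Rightarrow> 'a::idom"
  assumes "finite E" "finite K" "card E < card K"
  shows "\<exists>c. (\<exists>k\<in>K. c k \<noteq> 0) \<and> (\<forall>e\<in>E. (\<Sum>k\<in>K. A e k * c k) = 0)"
  using assms
proof (induction E arbitrary: K A rule: finite_induct)
  case empty
  then have "K \<noteq> {}" by auto
  then show ?case by (intro exI[of _ "\<lambda>_. 1"]) auto
next
  case (insert e E)
  show ?case
  proof (cases "\<forall>k\<in>K. A e k = 0")
    case True
    have "card E < card K" using insert by simp
    from insert.IH[OF insert.prems(1) this, of A] obtain c where
      "\<exists>k\<in>K. c k \<noteq> 0" "\<forall>e\<in>E. (\<Sum>k\<in>K. A e k * c k) = 0" by blast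
    with True show ?thesis by (intro exI[of _ c]) auto
  next
    case False
    then obtain j where j: "j \<in> K" "A e j \<noteq> 0" by blast
    let ?K = "K - {j}"
    let ?A = "\<lambda>i k. A e j * A i k - A i j * A e k"
    have "card E < card ?K" using insert j by simp
    from insert.IH[OF _ this, of ?A] insert.prems obtain d where
      d: "\<exists>k\<in>?K. d k \<noteq> 0" "\<forall>i\<in>E. (\<Sum>k\<in>?K. ?A i k * d k) = 0" by auto
    define c where "c k = (if k = j then - (\<Sum>k\<in>?K. A e k * d k) else A e j * d k)" for k
    have *: "(\<Sum>k\<in>K. A i k * c k) = (\<Sum>k\<in>?K. ?A i k * d k)" for i
    proof -
      have "(\<Sum>k\<in>K. A i k * c k) = A i j * c j + (\<Sum>k\<in>?K. A i k * c k)"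
        using insert.prems(1) j(1) by (simp add: sum.remove)
      also have "(\<Sum>k\<in>?K. A i k * c k) = (\<Sum>k\<in>?K. A e j * A i k * d k)"
        by (intro sum.cong) (auto simp: c_def)
      also have "A i j * c j = - (\<Sum>k\<in>?K. A i j * A e k * d k)"
        by (simp add: c_def sum_distrib_left mult.assoc)
      finally show ?thesis by (simp add: algebra_simps sum_subtractf)
    qed
    have "\<exists>k\<in>K. c k \<noteq> 0" using d(1) j by (auto simp: c_def)
    moreover have "(\<Sum>k\<in>K. A i k * c k) = 0" if "i \<in> insert e E" for i
      unfolding * using that d(2) by (auto simp: mult.commute)
    ultimately show ?thesis by blast
  qed
qed

text \<open>A nonzero integer solution with least sum of absolute values works: were all its entries
  divisible by \<open>p\<close>, the quotient would be a smaller nonzero solution.\<close>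

lemma underdetermined_system_solvable_not_dvd:
  fixes A :: "'i \<Rightarrow> 'k \<Rightarrow> int"
  assumes "finite E" "finite K" "card E < card K" and p: "p > 1"
  shows "\<exists>c. (\<exists>k\<in>K. \<not> p dvd c k) \<and> (\<forall>e\<in>E. (\<Sum>k\<in>K. A e k * c k) = 0)"
proof -
  let ?P = "\<lambda>c. (\<exists>k\<in>K. c k \<noteq> 0) \<and> (\<forall>e\<in>E. (\<Sum>k\<in>K. A e k * c k) = 0)"
  define m where "m c = nat (\<Sum>k\<in>K. \<bar>c k\<bar>)" for c :: "'k \<Rightarrow> int"
  from underdetermined_system_solvable[OF assms(1-3), of A] obtain c where "?P c" by blast
  from ex_has_least_nat[of ?P, OF this, of m] obtain c where
    c: "?P c" and least: "\<And>d. ?P d \<Longrightarrow> m c \<le> m d" by blast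
  have "\<exists>k\<in>K. \<not> p dvd c k"
  proof (rule ccontr)
    assume "\<not> ?thesis"
    then have dv: "c k = p * (c k div p)" if "k \<in> K" for k using that by auto
    define d where "d k = c k div p" for k
    have cd: "c k = p * d k" if "k \<in> K" for k using dv[OF that] by (simp add: d_def)
    have "(\<Sum>k\<in>K. A e k * c k) = p * (\<Sum>k\<in>K. A e k * d k)" for e
      by (simp add: sum_distrib_left cd mult.left_commute cong: sum.cong)
    then have "?P d" using c p cd by auto
    from least[OF this] have le: "m c \<le> m d" .
    have "(\<Sum>k\<in>K. \<bar>c k\<bar>) = p * (\<Sum>k\<in>K. \<bar>d k\<bar>)"
      using p by (simp add: sum_distrib_left cd abs_mult cong: sum.cong)
    moreover have "(\<Sum>k\<in>K. \<bar>d k\<bar>) > 0"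
    proof -
      from \<open>?P d\<close> obtain k where "k \<in> K" "d k \<noteq> 0" by blast
      then show ?thesis using assms(2) by (intro sum_pos2[of _ k]) auto
    qed
    moreover have "p * (\<Sum>k\<in>K. \<bar>d k\<bar>) > 1 * (\<Sum>k\<in>K. \<bar>d k\<bar>)"
      using p calculation(2) by (intro mult_strict_right_mono) auto
    ultimately have "m d < m c" unfolding m_def by simp
    with le show False by simp
  qed
  with c show ?thesis by blast
qed

lemma monic_division:
  fixes f g :: "'a::comm_ring_1 poly"
  assumes "lead_coeff g = 1"
  obtains q r where "f = q * g + r" "r = 0 \<or> degree r < degree g"
proof -
  have g0: "g \<noteq> 0" using assms by auto
  obtain q r where qr: "pseudo_divmod f g = (q, r)" by force
  from pseudo_divmod[OF g0 qr] assms have "f = q * g + r" "r = 0 \<or> degree r < degree g"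
    by (auto simp: mult.commute)
  then show ?thesis by (rule that)
qed

lemma inj_on_powers_primitive_root:
  fixes z :: complex
  assumes p: "prime p" and k: "k \<ge> 1" and z: "z ^ (p ^ k) = 1" "z ^ (p ^ (k - 1)) \<noteq> 1"
  shows "inj_on (\<lambda>t. z ^ t) {..<p ^ k}"
proof -
  have z0: "z \<noteq> 0" using z p by (auto simp: power_0_left prime_gt_0_nat split: if_splits)
  have no: "z ^ d \<noteq> 1" if d: "0 < d" "d < p ^ k" for d
  proof
    assume zd: "z ^ d = 1"
    obtain x y where xy: "d * x = p ^ k * y + gcd d (p ^ k)"
      using bezout_nat[of d "p ^ k"] d by auto
    have "z ^ (d * x) = 1" by (simp add: power_mult zd)
    moreover have "z ^ (p ^ k * y + gcd d (p ^ k)) = z ^ gcd d (p ^ k)"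
      by (simp add: power_add power_mult z)
    ultimately have zg: "z ^ gcd d (p ^ k) = 1" using xy by simp
    obtain j where j: "j \<le> k" "gcd d (p ^ k) = p ^ j"
      using divides_primepow_nat[OF p, of "gcd d (p ^ k)" k] by auto
    have "p ^ j < p ^ k" using j d
      by (metis dual_order.strict_trans2 gcd_le1_nat less_numeral_extra(3) linorder_not_le)
    then have "j < k" using p by (metis power_less_imp_less_exp prime_gt_1_nat)
    then have "p ^ j dvd p ^ (k - 1)" by (intro le_imp_power_dvd) auto
    then obtain e where "p ^ (k - 1) = p ^ j * e" by auto
    then have "z ^ (p ^ (k - 1)) = 1" using zg j by (simp add: power_mult)
    with z show False by simp
  qed
  have *: False if "s < t" "t < p ^ k" "z ^ s = z ^ t" for s t
  proof -
    have "z ^ t = z ^ s * z ^ (t - s)" using that(1) by (subst power_add[symmetric]) simp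
    then have "z ^ (t - s) = 1" using that z0 by simp
    with no[of "t - s"] that show False by (simp add: less_imp_diff_less)
  qed
  show ?thesis
    by (rule inj_onI) (metis * lessThan_iff nat_neq_iff)
qed

text \<open>Every primitive root of unity of order \<open>p ^ k\<close> is congruent to \<open>1\<close> modulo a prime
  above \<open>p\<close>; the proof divides by the cyclotomic polynomial, whose value at \<open>1\<close> is \<open>p\<close>.\<close>

lemma dvd_poly_1_if_vanishes_on_primitive_roots:
  fixes D :: "int poly"
  assumes p: "prime p" and k: "k \<ge> 1"
    and D: "\<And>z::complex. z ^ (p ^ k) = 1 \<Longrightarrow> inj_on (\<lambda>t. z ^ t) {..<p ^ k} \<Longrightarrow>
              poly (of_int_poly D) z = 0"
  shows "int p dvd poly D 1"
proof -
  define q where "q = p ^ (k - 1)"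
  have q0: "q > 0" using p by (simp add: q_def prime_gt_0_nat)
  have p1: "p > 1" using p by (rule prime_gt_1_nat)
  have pk: "p ^ k = q * p" using k by (simp add: q_def flip: power_Suc2)
  define C :: "int poly" where "C = (\<Sum>i<p. monom 1 (i * q))"
  have "coeff C ((p - 1) * q) = (\<Sum>i<p. if i = p - 1 then 1 else 0)"
    unfolding C_def coeff_sum by (intro sum.cong) (use q0 in auto)
  also have "\<dots> = 1" using p1 by simp
  finally have c1: "coeff C ((p - 1) * q) = 1" .
  have "degree C \<le> (p - 1) * q" unfolding C_def
    by (intro degree_sum_le) (auto simp: degree_monom_eq intro!: mult_le_mono)
  with c1 have dC: "degree C = (p - 1) * q"
    by (metis le_antisym le_degree one_neq_zero)
  obtain Q R where QR: "D = Q * C + R" "R = 0 \<or> degree R < degree C"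
    using monic_division[of C D] c1 dC by metis
  define Z where "Z = {z::complex. z ^ (p ^ k) = 1 \<and> z ^ q \<noteq> 1}"
  have Zeq: "Z = {z. z ^ (p ^ k) = 1} - {z. z ^ q = 1}" by (auto simp: Z_def)
  have sub: "{z::complex. z ^ q = 1} \<subseteq> {z. z ^ (p ^ k) = 1}" by (auto simp: pk power_mult)
  have card_roots: "card {z::complex. z ^ n = 1} = n" if "n > 0" for n
    using card_roots_unity_eq[of n] that by simp
  have "card Z = p ^ k - q"
    unfolding Zeq using q0 p1 pk sub
    by (subst card_Diff_subset) (auto simp: card_roots intro!: finite_roots_unity)
  then have cZ: "card Z = degree C" unfolding dC pk by (simp add: algebra_simps)
  have R0: "poly (of_int_poly R) z = 0" if "z \<in> Z" for z :: complex
  proof -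
    have z: "z ^ (p ^ k) = 1" "z ^ q \<noteq> 1" using that by (auto simp: Z_def)
    have "poly (of_int_poly D) z = 0"
      by (rule D) (use z inj_on_powers_primitive_root[OF p k] in \<open>auto simp: q_def\<close>)
    moreover have "poly (of_int_poly C) z = (\<Sum>i<p. (z ^ q) ^ i)"
      unfolding C_def by (simp add: hom_distribs poly_sum poly_monom mult.commute flip: power_mult)
    moreover have "\<dots> = 0" using z geometric_sum[of "z ^ q" p] by (simp add: pk power_mult)
    ultimately show ?thesis unfolding QR(1) by (simp add: hom_distribs)
  qed
  have "R = 0"
  proof (rule ccontr)
    assume "R \<noteq> 0"
    then have R': "(of_int_poly R :: complex poly) \<noteq> 0" "degree R < degree C" using QR by auto
    have "card Z \<le> card {z::complex. poly (of_int_poly R) z = 0}"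
      by (rule card_mono) (use R' R0 in \<open>auto intro: poly_roots_finite\<close>)
    also have "\<dots> \<le> degree (of_int_poly R :: complex poly)" by (rule card_poly_roots_bound[OF R'(1)])
    finally show False using R' cZ by simp
  qed
  then have "poly D 1 = poly Q 1 * poly C 1" using QR by simp
  moreover have "poly C 1 = int p" by (simp add: C_def poly_sum poly_monom)
  ultimately show ?thesis by simp
qed

subsection \<open>Orders modulo a prime\<close>

text \<open>A lower bound for the valuation at \<open>0\<close> of \<open>g\<close> modulo
  \<open>P\<close>, with \<open>ord_eq\<close> for the exact valuation. Divisibility of coefficients
  expresses it without passing to a quotient ring.\<close>

definition ord_ge :: "'a::comm_ring_1 \<Rightarrow> nat \<Rightarrow> 'a poly \<Rightarrow> bool" where
  "ord_ge P s g \<longleftrightarrow> (\<forall>i<s. P dvd coeff g i)"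

definition ord_eq :: "'a::comm_ring_1 \<Rightarrow> nat \<Rightarrow> 'a poly \<Rightarrow> bool" where
  "ord_eq P s g \<longleftrightarrow> ord_ge P s g \<and> \<not> P dvd coeff g s"

lemma ord_ge_mono: "ord_ge P s g \<Longrightarrow> t \<le> s \<Longrightarrow> ord_ge P t g"
  by (auto simp: ord_ge_def)

lemma ord_ge_0 [simp]: "ord_ge P s 0"
  by (simp add: ord_ge_def)

lemma ord_ge_zero_order [simp]: "ord_ge P 0 g"
  by (simp add: ord_ge_def)

lemma ord_ge_add: "ord_ge P s g \<Longrightarrow> ord_ge P s h \<Longrightarrow> ord_ge P s (g + h)"
  by (auto simp: ord_ge_def)

lemma ord_ge_diff: "ord_ge P s g \<Longrightarrow> ord_ge P s h \<Longrightarrow> ord_ge P s (g - h)"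
  by (auto simp: ord_ge_def)

lemma ord_ge_sum: "(\<And>x. x \<in> A \<Longrightarrow> ord_ge P s (f x)) \<Longrightarrow> ord_ge P s (\<Sum>x\<in>A. f x)"
  by (induction A rule: infinite_finite_induct) (auto intro: ord_ge_add)

lemma ord_ge_smult: "P dvd c \<Longrightarrow> ord_ge P s (smult c g)"
  by (auto simp: ord_ge_def)

lemma ord_ge_monom: "ord_ge P s (monom c s)"
  by (auto simp: ord_ge_def)

lemma ord_ge_mult:
  assumes "ord_ge P s g" "ord_ge P t h"
  shows "ord_ge P (s + t) (g * h)"
  unfolding ord_ge_def
proof (intro allI impI)
  fix i assume i: "i < s + t"
  show "P dvd coeff (g * h) i" unfolding coeff_mult
  proof (rule dvd_sum)
    fix j assume "j \<in> {..i}"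
    then have "j < s \<or> i - j < t" using i by auto
    then show "P dvd coeff g j * coeff h (i - j)" using assms by (auto simp: ord_ge_def)
  qed
qed

lemma ord_ge_prod:
  "(\<And>x. x \<in> A \<Longrightarrow> ord_ge P (s x) (f x)) \<Longrightarrow> ord_ge P (\<Sum>x\<in>A. s x) (\<Prod>x\<in>A. f x)"
  by (induction A rule: infinite_finite_induct) (auto intro: ord_ge_mult)

lemma ord_eq_ge: "ord_eq P s g \<Longrightarrow> ord_ge P s g"
  by (simp add: ord_eq_def)

lemma ord_eq_not_ge: "ord_eq P s g \<Longrightarrow> s < t \<Longrightarrow> \<not> ord_ge P t g"
  by (auto simp: ord_eq_def ord_ge_def)

lemma ord_eq_add:
  assumes "ord_eq P s g" "ord_ge P t h" "s < t"
  shows "ord_eq P s (g + h)"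
  using assms by (auto simp: ord_eq_def ord_ge_def dvd_add_left_iff)

lemma ord_eq_minus: "ord_eq P s (- g) \<longleftrightarrow> ord_eq P s g"
  by (simp add: ord_eq_def ord_ge_def)

lemma ord_eq_mult:
  assumes P: "prime_elem P" and g: "ord_eq P s g" and h: "ord_eq P t h"
  shows "ord_eq P (s + t) (g * h)"
proof -
  have "coeff (g * h) (s + t) =
          coeff g s * coeff h t + (\<Sum>j\<in>{..s + t} - {s}. coeff g j * coeff h (s + t - j))"
    unfolding coeff_mult by (subst sum.remove[of _ s]) auto
  moreover have "P dvd (\<Sum>j\<in>{..s + t} - {s}. coeff g j * coeff h (s + t - j))"
  proof (rule dvd_sum)
    fix j assume "j \<in> {..s + t} - {s}"
    then have "j < s \<or> s + t - j < t" by auto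
    then show "P dvd coeff g j * coeff h (s + t - j)"
      using g h by (auto simp: ord_eq_def ord_ge_def)
  qed
  moreover have "\<not> P dvd coeff g s * coeff h t"
    using P g h by (auto simp: ord_eq_def prime_elem_dvd_mult_iff)
  ultimately have "\<not> P dvd coeff (g * h) (s + t)" by (simp add: dvd_add_left_iff)
  then show ?thesis using g h by (auto simp: ord_eq_def intro: ord_ge_mult)
qed

lemma ord_eq_1: "prime_elem P \<Longrightarrow> ord_eq P 0 1"
  by (simp add: ord_eq_def prime_elem_def)

lemma ord_eq_prod:
  assumes "prime_elem P" "\<And>x. x \<in> A \<Longrightarrow> ord_eq P (s x) (f x)"
  shows "ord_eq P (\<Sum>x\<in>A. s x) (\<Prod>x\<in>A. f x)"
  using assms(2)
  by (induction A rule: infinite_finite_induct) (auto intro: ord_eq_mult ord_eq_1 assms(1))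

lemma coeff_one_plus_X_power:
  "coeff ([:1, 1:] ^ n) i = (of_nat (n choose i) :: 'a::comm_ring_1)"
proof (induction n arbitrary: i)
  case (Suc n)
  show ?case by (cases i) (simp_all add: Suc coeff_pCons)
qed (auto simp: binomial_eq_0)

lemma of_nat_dvd_of_nat: "m dvd n \<Longrightarrow> (of_nat m :: 'a::comm_ring_1) dvd of_nat n"
  by (metis of_nat_mult dvdE dvdI)

text \<open>Iterated Frobenius: \<open>a - b\<close> divides \<open>a ^ p - b ^ p\<close>, so the
  congruence survives raising to the power \<open>p\<close>, and the case of exponent
  \<open>p\<close> is then applied to \<open>y ^ (p ^ r)\<close>.\<close>

lemma binomial_prime_power_cong:
  fixes y :: "'a::comm_ring_1"
  assumes p: "prime p"
  shows "of_nat p dvd (1 + y) ^ (p ^ r) - (1 + y ^ (p ^ r))"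
proof (induction r)
  case (Suc r)
  have one: "of_nat p dvd (1 + z) ^ p - (1 + z ^ p)" for z :: 'a
  proof -
    have "{..p} = insert 0 (insert p {0<..<p})" using prime_gt_0_nat[OF p] by auto
    then have "(1 + z) ^ p = 1 + z ^ p + (\<Sum>k\<in>{0<..<p}. of_nat (p choose k) * z ^ k)"
      using binomial_ring[of z 1 p] prime_gt_0_nat[OF p] by (simp add: add.commute)
    moreover have "of_nat p dvd (\<Sum>k\<in>{0<..<p}. of_nat (p choose k) * z ^ k)"
      by (intro dvd_sum dvd_mult2 of_nat_dvd_of_nat dvd_choose_prime) (use p in auto)
    ultimately show ?thesis by simp
  qed
  have "(1 + y) ^ (p ^ r) - (1 + y ^ (p ^ r)) dvd
        ((1 + y) ^ (p ^ r)) ^ p - (1 + y ^ (p ^ r)) ^ p"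
    by (subst power_diff_sumr2) simp
  with Suc.IH have "of_nat p dvd ((1 + y) ^ (p ^ r)) ^ p - (1 + y ^ (p ^ r)) ^ p"
    using dvd_trans by blast
  from dvd_add[OF this one[of "y ^ (p ^ r)"]]
  have "of_nat p dvd ((1 + y) ^ (p ^ r)) ^ p - (1 + (y ^ (p ^ r)) ^ p)" by (simp add: algebra_simps)
  then show ?case unfolding power_Suc2 power_mult .
qed simp

subsection \<open>Interpolation nodes\<close>

text \<open>The \<open>i\<close>-th positive integer that is prime to \<open>p\<close>.\<close>

definition unit_node :: "nat \<Rightarrow> nat \<Rightarrow> nat" where
  "unit_node p i = i + i div (p - 1) + 1"

lemma unit_node_eq:
  assumes "prime p"
  shows "unit_node p i = p * (i div (p - 1)) + i mod (p - 1) + 1"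
proof -
  have "i = (p - 1) * (i div (p - 1)) + i mod (p - 1)" by simp
  moreover have "p * (i div (p - 1)) = (p - 1) * (i div (p - 1)) + i div (p - 1)"
    using prime_gt_0_nat[OF assms] by (cases p) auto
  ultimately show ?thesis by (simp add: unit_node_def)
qed

lemma not_dvd_unit_node:
  assumes "prime p"
  shows "\<not> p dvd unit_node p i"
proof
  have p: "p > 1" using assms by (rule prime_gt_1_nat)
  assume "p dvd unit_node p i"
  then have "p dvd p * (i div (p - 1)) + (i mod (p - 1) + 1)"
    using unit_node_eq[OF assms, of i] by (simp add: add.assoc)
  then have "p dvd i mod (p - 1) + 1" by (simp only: dvd_add_right_iff[OF dvd_triv_left])
  moreover have "i mod (p - 1) < p - 1" using p by simp
  then have "i mod (p - 1) + 1 < p" by linarith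
  ultimately show False by (simp add: nat_dvd_not_less)
qed

lemma unit_node_less: "j < i \<Longrightarrow> unit_node p j < unit_node p i"
  unfolding unit_node_def by (simp add: add_less_le_mono div_le_mono)

text \<open>Divisibility by \<open>p\<close> forces equal remainders modulo \<open>p - 1\<close>;
  the nodes then differ by \<open>p\<close> times the difference of the quotients. The modulus
  \<open>(p - 1) * p ^ r\<close> equals \<open>p ^ Suc r - p ^ r\<close>, the weight with which such
  pairs are counted in \<open>sum_node_ord_le\<close>.\<close>

lemma prime_power_dvd_unit_node_diff:
  assumes p: "prime p" and dv: "int p ^ Suc r dvd int (unit_node p i) - int (unit_node p j)"
  shows "int ((p - 1) * p ^ r) dvd int i - int j"
proof -
  have p1: "p > 1" using p by (rule prime_gt_1_nat)
  define a b c d where "a = int (i div (p - 1))" and "b = int (i mod (p - 1))"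
    and "c = int (j div (p - 1))" and "d = int (j mod (p - 1))"
  have ij: "int i = int (p - 1) * a + b" "int j = int (p - 1) * c + d"
    by (simp_all add: a_def b_def c_def d_def flip: of_nat_mult of_nat_add)
  have diff: "int (unit_node p i) - int (unit_node p j) = int p * (a - c) + (b - d)"
    unfolding unit_node_eq[OF p] a_def b_def c_def d_def by (simp add: algebra_simps)
  have bd: "b \<ge> 0" "b < int p - 1" "d \<ge> 0" "d < int p - 1"
    using p1 by (auto simp: b_def d_def zmod_int of_nat_diff)
  have "int p dvd int p * (a - c) + (b - d)" using dv diff by (metis dvd_mult_left power_Suc)
  then have "int p dvd b - d" by (simp only: dvd_add_right_iff[OF dvd_triv_left])
  then have "b - d = 0" using bd dvd_imp_le_int[of "b - d" "int p"] by linarith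
  with dv diff have "int p ^ r dvd a - c" using p1 by auto
  moreover have "int i - int j = int (p - 1) * (a - c)" using ij \<open>b - d = 0\<close> by (simp add: algebra_simps)
  ultimately show ?thesis by (simp add: mult_dvd_mono)
qed

lemma card_congruent_atMost:
  assumes "m > 0" "i \<le> j"
  shows "m * card {i' \<in> {..j} - {i}. int m dvd int i - int i'} \<le> j"
proof -
  let ?S = "{i' \<in> {..j}. int m dvd int i - int i'}"
  have cong: "a mod m = i mod m" if "int m dvd int i - int a" for a
    using that by (metis mod_eq_dvd_iff of_nat_eq_iff zmod_int)
  have "inj_on (\<lambda>i'. i' div m) ?S"
    by (rule inj_onI) (metis (mono_tags, lifting) cong div_mult_mod_eq mem_Collect_eq)
  then have "card ?S \<le> card {..j div m}"
    by (rule card_inj_on_le) (auto simp: div_le_mono)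
  moreover have "{i' \<in> {..j} - {i}. int m dvd int i - int i'} = ?S - {i}" by auto
  moreover have "i \<in> ?S" using assms by simp
  ultimately have "card {i' \<in> {..j} - {i}. int m dvd int i - int i'} \<le> j div m" by simp
  then have "m * card {i' \<in> {..j} - {i}. int m dvd int i - int i'} \<le> m * (j div m)" by simp
  also have "\<dots> \<le> j" by simp
  finally show ?thesis .
qed

text \<open>The order at which two nodes separate modulo \<open>p\<close>: Frobenius gives
  \<open>p ^ v\<close> for exponents whose difference has valuation \<open>v\<close>, and the
  displacement caps it at \<open>p ^ l\<close>.\<close>

definition node_ord :: "nat \<Rightarrow> nat \<Rightarrow> nat \<Rightarrow> nat \<Rightarrow> nat" where
  "node_ord p l i j = p ^ min l (multiplicity (int p) (int (unit_node p i) - int (unit_node p j)))"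

lemma node_ord_commute: "node_ord p l i j = node_ord p l j i"
  unfolding node_ord_def by (metis dvd_diff_commute multiplicity_cong)

text \<open>Telescoping turns the power into a weighted count of congruences, which can be summed
  over the nodes one modulus at a time.\<close>

lemma power_min_multiplicity:
  assumes "p > 1" "d \<noteq> 0"
  shows "p ^ min l (multiplicity (int p) d) =
           1 + (\<Sum>r<l. if int p ^ Suc r dvd d then p ^ Suc r - p ^ r else 0)"
proof (induction l)
  case (Suc l)
  have dv: "int p ^ Suc l dvd d \<longleftrightarrow> Suc l \<le> multiplicity (int p) d"
    using assms by (intro power_dvd_iff_le_multiplicity) auto
  show ?case
  proof (cases "Suc l \<le> multiplicity (int p) d")
    case True
    then have "min l (multiplicity (int p) d) = l" "min (Suc l) (multiplicity (int p) d) = Suc l" by auto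
    moreover have "p ^ Suc l = p ^ l + (p ^ Suc l - p ^ l)" using assms by simp
    ultimately show ?thesis using Suc.IH dv True by (simp del: power_Suc)
  next
    case False
    then have "min (Suc l) (multiplicity (int p) d) = min l (multiplicity (int p) d)" by auto
    then show ?thesis using Suc.IH dv False by (simp del: power_Suc)
  qed
qed simp

lemma sum_node_ord_le:
  assumes p: "prime p" and ij: "i \<le> j"
  shows "(\<Sum>i'\<in>{..j} - {i}. node_ord p l i i') \<le> (1 + l) * j"
proof -
  have p1: "p > 1" using p by (rule prime_gt_1_nat)
  let ?A = "{..j} - {i}"
  let ?d = "\<lambda>i'. int (unit_node p i) - int (unit_node p i')"
  have ne: "?d i' \<noteq> 0" if "i' \<in> ?A" for i'
    using that unit_node_less[of i i' p] unit_node_less[of i' i p]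
    by (cases "i < i'") auto
  have "(\<Sum>i'\<in>?A. node_ord p l i i') =
        (\<Sum>i'\<in>?A. 1 + (\<Sum>r<l. if int p ^ Suc r dvd ?d i' then p ^ Suc r - p ^ r else 0))"
    unfolding node_ord_def using p1 ne by (intro sum.cong power_min_multiplicity) auto
  also have "\<dots> = card ?A + (\<Sum>i'\<in>?A. \<Sum>r<l. if int p ^ Suc r dvd ?d i' then p ^ Suc r - p ^ r else 0)"
    by (simp only: sum.distrib) simp
  also have "(\<Sum>i'\<in>?A. \<Sum>r<l. if int p ^ Suc r dvd ?d i' then p ^ Suc r - p ^ r else 0) =
             (\<Sum>r<l. \<Sum>i'\<in>?A. if int p ^ Suc r dvd ?d i' then p ^ Suc r - p ^ r else 0)"
    by (rule sum.swap)
  \<comment> \<open>For each \<open>r\<close> the weight equals the modulus of the congruence on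
    indices, and a modulus times its number of congruent indices is at most \<open>j\<close>.
    Together with the leading \<open>1\<close> this gives the factor \<open>1 + l\<close>.\<close>
  also have "\<dots> \<le> (\<Sum>r<l. j)"
  proof (rule sum_mono)
    fix r
    let ?m = "(p - 1) * p ^ r"
    have m: "p ^ Suc r - p ^ r = ?m" by (simp add: diff_mult_distrib)
    have "(\<Sum>i'\<in>?A. if int p ^ Suc r dvd ?d i' then p ^ Suc r - p ^ r else 0)
            \<le> (\<Sum>i'\<in>?A. if int ?m dvd int i - int i' then ?m else 0)"
      unfolding m using prime_power_dvd_unit_node_diff[OF p] by (intro sum_mono) (simp del: power_Suc)
    also have "\<dots> = ?m * card {i' \<in> ?A. int ?m dvd int i - int i'}"
      by (subst sum.inter_filter[symmetric]) simp_all
    also have "\<dots> \<le> j" using p1 ij by (intro card_congruent_atMost) auto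
    finally show "(\<Sum>i'\<in>?A. if int p ^ Suc r dvd ?d i' then p ^ Suc r - p ^ r else 0) \<le> j" .
  qed
  finally show ?thesis using ij by simp
qed

text \<open>The outer variable of \<open>int poly poly\<close> is the local parameter; the inner variable makes the
  displacements of the nodes pairwise incongruent modulo \<open>p\<close>, which a constant could not do.\<close>

definition node_disp :: "nat \<Rightarrow> nat \<Rightarrow> int poly poly" where
  "node_disp s i = monom (monom 1 i) s"

text \<open>A coordinate \<open>(1 + \<tau>) ^ u * (1 + y)\<close> with \<open>y\<close> specialised
  to a term of order \<open>p ^ l\<close>. Each factor \<open>y\<close> thus costs
  \<open>p ^ l\<close>, which is why a transversal derivative has that weight.\<close>

definition node :: "nat \<Rightarrow> nat \<Rightarrow> nat \<Rightarrow> int poly poly" where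
  "node p l i = [:1, 1:] ^ unit_node p i * (1 + node_disp (p ^ l) i)"

lemma of_nat_dvd_int_poly_iff: "(of_nat p :: int poly) dvd g \<longleftrightarrow> (\<forall>i. int p dvd coeff g i)"
  by (simp add: of_nat_poly const_poly_dvd_iff)

lemma prime_elem_of_nat_int_poly: "prime p \<Longrightarrow> prime_elem (of_nat p :: int poly)"
  by (simp add: of_nat_poly prime_elem_const_poly_iff)

lemma ord_eq_one_plus_X_power:
  assumes "prime p"
  shows "ord_eq (of_nat p :: int poly) 0 ([:1, 1:] ^ n)"
  using prime_elem_of_nat_int_poly[OF assms]
  by (simp add: ord_eq_def coeff_one_plus_X_power prime_elem_def)

text \<open>With \<open>Y = (1 + \<tau>) ^ (p ^ r)\<close> the polynomial is \<open>Y - 1\<close>,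
  of order \<open>p ^ r\<close> by Frobenius, times a geometric sum with constant coefficient
  \<open>d\<close>.\<close>

lemma ord_eq_one_plus_X_power_minus_1:
  assumes p: "prime p" and d: "\<not> p dvd d"
  shows "ord_eq (of_nat p :: int poly) (p ^ r) ([:1, 1:] ^ (p ^ r * d) - 1)"
proof -
  let ?P = "of_nat p :: int poly"
  let ?X = "[:0, 1:] :: int poly poly"
  let ?Y = "[:1, 1:] ^ (p ^ r) :: int poly poly"
  have pe: "prime_elem ?P" by (rule prime_elem_of_nat_int_poly[OF p])
  have nd: "\<not> ?P dvd 1" using pe by (simp add: prime_elem_def)
  have X1: "[:1, 1:] = 1 + ?X" by (simp add: one_pCons)
  obtain A where A: "?Y - (1 + ?X ^ (p ^ r)) = of_nat p * A"
    using binomial_prime_power_cong[OF p, of ?X r] unfolding X1 by (auto elim: dvdE)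
  have Y: "?Y - 1 = monom 1 (p ^ r) + smult ?P A"
    using A by (simp add: of_nat_poly algebra_simps monom_altdef)
  have 1: "ord_eq ?P (p ^ r) (?Y - 1)"
    unfolding Y using nd by (auto simp: ord_eq_def ord_ge_def dvd_add_left_iff)
  have "coeff (\<Sum>i<d. ?Y ^ i) 0 = (of_nat d :: int poly)"
    by (simp add: coeff_sum coeff_one_plus_X_power flip: power_mult)
  moreover have "\<not> ?P dvd of_nat d"
  proof
    assume "?P dvd of_nat d"
    then have "int p dvd coeff (of_nat d :: int poly) 0" by (simp only: of_nat_dvd_int_poly_iff)
    then show False using d by (simp add: of_nat_poly)
  qed
  ultimately have 2: "ord_eq ?P 0 (\<Sum>i<d. ?Y ^ i)" by (simp add: ord_eq_def)
  have "[:1, 1:] ^ (p ^ r * d) - 1 = (?Y - 1) * (\<Sum>i<d. ?Y ^ i)"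
    by (simp add: power_mult power_diff_1_eq)
  then show ?thesis using ord_eq_mult[OF pe 1 2] by simp
qed

lemma ord_ge_node_disp: "ord_ge P s (node_disp s i)"
  unfolding node_disp_def by (rule ord_ge_monom)

text \<open>If the valuation \<open>v\<close> of the exponent difference is below \<open>l\<close>,
  the exponents separate the nodes before the displacement sets in. Otherwise the coefficient at
  order \<open>p ^ l\<close> decides, and there the displacements differ.\<close>

lemma ord_eq_node_diff_aux:
  assumes p: "prime p" and ji: "j < i"
  shows "ord_eq (of_nat p) (node_ord p l i j) (node p l i - node p l j)"
proof -
  let ?P = "of_nat p :: int poly"
  let ?q = "p ^ l"
  have p1: "p > 1" using p by (rule prime_gt_1_nat)
  have pe: "prime_elem ?P" by (rule prime_elem_of_nat_int_poly[OF p])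
  define d where "d = unit_node p i - unit_node p j"
  have d0: "d > 0" and di: "unit_node p i = unit_node p j + d"
    using unit_node_less[OF ji, of p] by (auto simp: d_def)
  define v where "v = multiplicity p d"
  have "int (unit_node p i) - int (unit_node p j) = int d" using di by simp
  then have no: "node_ord p l i j = p ^ min l v"
    by (simp add: node_ord_def v_def multiplicity_def flip: of_nat_power)
  obtain e where e: "d = p ^ v * e" "\<not> p dvd e"
    using multiplicity_decompose'[of d p] d0 p1 v_def by (metis nat_dvd_1_iff_1 not_less_iff_gr_or_eq)
  let ?Z = "[:1, 1:] ^ d :: int poly poly"
  define B where "B = (?Z - 1) + (?Z * node_disp ?q i - node_disp ?q j)"
  have fact: "node p l i - node p l j = [:1, 1:] ^ unit_node p j * B"
    unfolding node_def B_def di by (simp add: algebra_simps power_add)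
  have Z1: "ord_eq ?P (p ^ v) (?Z - 1)"
    unfolding e(1) by (rule ord_eq_one_plus_X_power_minus_1[OF p e(2)])
  have disp: "ord_ge ?P ?q (?Z * node_disp ?q i - node_disp ?q j)"
    using ord_ge_mult[of ?P 0 ?Z ?q "node_disp ?q i"] ord_ge_node_disp[of ?P ?q]
    by (auto intro: ord_ge_diff)
  have "ord_eq ?P (p ^ min l v) B"
  proof (cases "v < l")
    case True
    then show ?thesis unfolding B_def using Z1 disp p1 by (auto intro: ord_eq_add)
  next
    case False
    then have "ord_ge ?P ?q (?Z - 1)" using Z1 p1 by (auto intro: ord_ge_mono ord_eq_ge)
    then have ge: "ord_ge ?P ?q B" unfolding B_def using disp by (rule ord_ge_add)
    have "coeff (?Z * node_disp ?q i) ?q = monom 1 i"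
      unfolding node_disp_def by (subst mult.commute) (simp add: coeff_monom_mult coeff_one_plus_X_power)
    then have "coeff B ?q = of_nat (d choose ?q) + (monom 1 i - monom 1 j)"
      using p1 unfolding B_def by (simp add: coeff_one_plus_X_power node_disp_def)
    \<comment> \<open>As \<open>j < i\<close>, the power \<open>i\<close> of the inner variable
      occurs neither in the constant binomial term nor in the displacement of node
      \<open>j\<close>.\<close>
    then have "coeff (coeff B ?q) i = 1" using ji by (simp add: of_nat_poly coeff_pCons split: nat.splits)
    then have "\<not> ?P dvd coeff B ?q" using p1 unfolding of_nat_dvd_int_poly_iff
      by (metis int_dvd_int_iff nat_dvd_1_iff_1 not_less_iff_gr_or_eq of_nat_1)
    with ge False show ?thesis by (simp add: ord_eq_def min_def)
  qed
  from ord_eq_mult[OF pe ord_eq_one_plus_X_power[OF p] this]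
  show ?thesis unfolding fact no by simp
qed

lemma ord_eq_node_diff:
  assumes "prime p" "i \<noteq> j"
  shows "ord_eq (of_nat p) (node_ord p l i j) (node p l i - node p l j)"
proof (cases "j < i")
  case False
  then have "ord_eq (of_nat p) (node_ord p l j i) (- (node p l i - node p l j))"
    using ord_eq_node_diff_aux[OF assms(1), of i j l] assms(2) by simp
  then show ?thesis by (simp only: ord_eq_minus node_ord_commute[of p l i j])
qed (use ord_eq_node_diff_aux assms in auto)

section \<open>Lagrange interpolation with cleared denominators\<close>

definition node_prod :: "(nat \<Rightarrow> 'a::comm_ring_1) \<Rightarrow> nat \<Rightarrow> nat \<Rightarrow> 'a" where
  "node_prod x j i = (\<Prod>i'\<in>{..j} - {i}. x i - x i')"

text \<open>The common denominator of Lagrange's formula without its factor at \<open>i\<close>,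
  that is, this denominator times the interpolation weight of node \<open>i\<close>, written without
  division.\<close>

definition node_cof :: "(nat \<Rightarrow> 'a::comm_ring_1) \<Rightarrow> nat \<Rightarrow> nat \<Rightarrow> 'a" where
  "node_cof x j i = (\<Prod>i'\<in>{..j} - {i}. node_prod x j i')"

text \<open>The leading coefficient of the interpolation polynomial, with denominators cleared.\<close>

lemma sum_node_cof_power:
  fixes x :: "nat \<Rightarrow> 'a::idom"
  assumes inj: "inj_on x {..j}" and v: "v \<le> j"
  shows "(\<Sum>i\<le>j. node_cof x j i * x i ^ v) = (if v = j then (\<Prod>i\<le>j. node_prod x j i) else 0)"
proof -
  let ?V = "\<Prod>i\<le>j. node_prod x j i"
  let ?G = "\<lambda>i. \<Prod>i'\<in>{..j} - {i}. [:- x i', 1:]"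
  define L where "L = (\<Sum>i\<le>j. smult (node_cof x j i * x i ^ v) (?G i))"
  have dG: "degree (?G i) = j" if "i \<le> j" for i
    using that by (subst degree_prod_eq_sum_degree) auto
  have cG: "coeff (?G i) j = 1" if "i \<le> j" for i
    using lead_coeff_prod[of "\<lambda>i'. [:- x i', 1:]" "{..j} - {i}"] dG[OF that] by simp
  have dL: "degree L \<le> j" unfolding L_def
    by (intro degree_sum_le) (auto intro: order.trans[OF degree_smult_le] simp: dG)
  have dM: "degree (monom ?V v) \<le> j" using v degree_monom_le order.trans by blast
  have eq: "poly L y = poly (monom ?V v) y" if "y \<in> x ` {..j}" for y
  proof -
    from that obtain a where a: "a \<le> j" "y = x a" by auto
    have "poly (?G i) (x a) = 0" if "i \<le> j" "i \<noteq> a" for i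
      using a that by (auto simp: poly_prod)
    then have "poly L (x a) = node_cof x j a * x a ^ v * poly (?G a) (x a)"
      unfolding L_def poly_sum using a by (subst sum.remove[of _ a]) auto
    also have "poly (?G a) (x a) = node_prod x j a" by (simp add: poly_prod node_prod_def)
    also have "node_cof x j a * x a ^ v * node_prod x j a = ?V * x a ^ v"
      unfolding node_cof_def using a by (subst prod.remove[of "{..j}" a]) (auto simp: mult_ac)
    finally show ?thesis using a by (simp add: poly_monom)
  qed
  have "L = monom ?V v"
  proof (rule ccontr)
    assume "L \<noteq> monom ?V v"
    then have ne: "L - monom ?V v \<noteq> 0" by simp
    have "Suc j = card (x ` {..j})" using inj by (simp add: card_image)
    also have "\<dots> \<le> card {y. poly (L - monom ?V v) y = 0}"
      by (rule card_mono) (use eq poly_roots_finite[OF ne] in auto)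
    also have "\<dots> \<le> degree (L - monom ?V v)" by (rule card_poly_roots_bound[OF ne])
    also have "\<dots> \<le> j" by (rule degree_diff_le[OF dL dM])
    finally show False by simp
  qed
  then have "coeff L j = (if v = j then ?V else 0)" by simp
  moreover have "coeff L j = (\<Sum>i\<le>j. node_cof x j i * x i ^ v)"
    unfolding L_def coeff_sum by (intro sum.cong) (auto simp: cG)
  ultimately show ?thesis by simp
qed

subsection \<open>Jets modulo a prime\<close>

text \<open>The coefficient of \<open>\<tau> ^ i * y ^ \<alpha>\<close> in the monomial \<open>x ^ v\<close> after the
  substitution \<open>x t = (1 + \<tau>) ^ u t * (1 + y t)\<close>.\<close>

definition jet_coeff :: "('n::finite \<Rightarrow> nat) \<Rightarrow> ('n \<Rightarrow> nat) \<Rightarrow> nat \<Rightarrow> ('n \<Rightarrow> nat) \<Rightarrow> nat" where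
  "jet_coeff u \<alpha> i v = (\<Prod>t\<in>UNIV. v t choose \<alpha> t) * ((\<Sum>t\<in>UNIV. u t * v t) choose i)"

lemma ord_ge_power: "ord_ge P s g \<Longrightarrow> ord_ge P (s * n) (g ^ n)"
  by (induction n) (auto intro: ord_ge_mult)

lemma inj_node:
  assumes "prime p"
  shows "inj_on (node p l) A"
proof (rule inj_onI, rule ccontr)
  fix i j assume eq: "node p l i = node p l j" and "i \<noteq> j"
  from ord_eq_node_diff[OF assms this(2), of l] eq show False by (simp add: ord_eq_def)
qed

lemma node_power:
  assumes "w \<le> N"
  shows "node p l i ^ w =
           (\<Sum>a\<le>N. of_nat (w choose a) * ([:1, 1:] ^ (unit_node p i * w) * node_disp (p ^ l) i ^ a))"
proof -
  have "(1 + node_disp (p ^ l) i) ^ w = (\<Sum>a\<le>w. of_nat (w choose a) * node_disp (p ^ l) i ^ a)"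
    using binomial_ring[of "node_disp (p ^ l) i" 1 w] by (simp add: add.commute)
  also have "\<dots> = (\<Sum>a\<le>N. of_nat (w choose a) * node_disp (p ^ l) i ^ a)"
    by (rule sum.mono_neutral_left) (use assms in \<open>auto simp: binomial_eq_0\<close>)
  finally show ?thesis
    by (simp add: node_def power_mult_distrib power_mult[of "[:1, 1:]"] sum_distrib_left mult.left_commute)
qed

text \<open>In the expansion by displacements the term at \<open>\<alpha>\<close> is
  \<open>D \<alpha> * B \<alpha>\<close>. The first factor has order at least
  \<open>p ^ l * sum \<alpha> UNIV\<close>; the second is a polynomial in \<open>\<tau>\<close>
  whose coefficients are the jets at \<open>\<alpha>\<close>. The weighted level adds the two
  orders.\<close>

lemma ord_ge_eval_at_nodes:
  fixes c :: "('n::finite \<Rightarrow> nat) \<Rightarrow> int"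
  assumes fin: "finite V"
    and H: "\<And>\<alpha> i. i + p ^ l * sum \<alpha> UNIV < s \<Longrightarrow>
              int p dvd (\<Sum>v\<in>V. c v * int (jet_coeff (\<lambda>t. unit_node p (g t)) \<alpha> i v))"
  shows "ord_ge (of_nat p :: int poly) s (\<Sum>v\<in>V. of_int (c v) * (\<Prod>t\<in>UNIV. node p l (g t) ^ v t))"
proof -
  let ?P = "of_nat p :: int poly"
  let ?q = "p ^ l"
  let ?u = "\<lambda>t. unit_node p (g t)"
  define N where "N = (\<Sum>v\<in>V. sum v UNIV)"
  have vN: "v t \<le> N" if "v \<in> V" for v t
  proof -
    have "v t \<le> sum v UNIV" by (rule member_le_sum) auto
    also have "\<dots> \<le> N" unfolding N_def using fin that by (intro member_le_sum) auto
    finally show ?thesis .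
  qed
  define I where "I = PiE (UNIV :: 'n set) (\<lambda>_. {..N})"
  define D where "D \<alpha> = (\<Prod>t\<in>UNIV. node_disp ?q (g t) ^ \<alpha> t)" for \<alpha>
  define B where "B \<alpha> = (\<Sum>v\<in>V. of_int (c v) * (of_nat (\<Prod>t\<in>UNIV. v t choose \<alpha> t) *
      [:1, 1:] ^ (\<Sum>t\<in>UNIV. ?u t * v t)) :: int poly poly)" for \<alpha>
  have expand: "(\<Prod>t\<in>UNIV. node p l (g t) ^ v t) =
      (\<Sum>\<alpha>\<in>I. D \<alpha> * (of_nat (\<Prod>t\<in>UNIV. v t choose \<alpha> t) * [:1, 1:] ^ (\<Sum>t\<in>UNIV. ?u t * v t)))"
    if "v \<in> V" for v
  proof -
    have "(\<Prod>t\<in>UNIV. node p l (g t) ^ v t) =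
      (\<Prod>t\<in>UNIV. \<Sum>a\<le>N. of_nat (v t choose a) * ([:1, 1:] ^ (?u t * v t) * node_disp ?q (g t) ^ a))"
      using vN[OF that] by (intro prod.cong node_power) auto
    also have "\<dots> = (\<Sum>\<alpha>\<in>I. \<Prod>t\<in>UNIV. of_nat (v t choose \<alpha> t) *
        ([:1, 1:] ^ (?u t * v t) * node_disp ?q (g t) ^ \<alpha> t))"
      unfolding I_def by (rule prod_sum_PiE) auto
    finally show ?thesis by (simp add: D_def prod.distrib power_sum mult_ac)
  qed
  have "(\<Sum>v\<in>V. of_int (c v) * (\<Prod>t\<in>UNIV. node p l (g t) ^ v t)) =
        (\<Sum>v\<in>V. \<Sum>\<alpha>\<in>I. D \<alpha> * (of_int (c v) * (of_nat (\<Prod>t\<in>UNIV. v t choose \<alpha> t) *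
          [:1, 1:] ^ (\<Sum>t\<in>UNIV. ?u t * v t))))"
    by (intro sum.cong refl) (simp add: expand sum_distrib_left mult_ac)
  also have "\<dots> = (\<Sum>\<alpha>\<in>I. D \<alpha> * B \<alpha>)"
    unfolding B_def by (subst sum.swap) (simp add: sum_distrib_left)
  finally have eq: "(\<Sum>v\<in>V. of_int (c v) * (\<Prod>t\<in>UNIV. node p l (g t) ^ v t)) = (\<Sum>\<alpha>\<in>I. D \<alpha> * B \<alpha>)" .
  show ?thesis unfolding eq
  proof (rule ord_ge_sum)
    fix \<alpha>
    have "ord_ge ?P (\<Sum>t\<in>UNIV. ?q * \<alpha> t) (D \<alpha>)"
      unfolding D_def by (intro ord_ge_prod ord_ge_power ord_ge_node_disp)
    then have 1: "ord_ge ?P (?q * sum \<alpha> UNIV) (D \<alpha>)" by (simp add: sum_distrib_left)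
    have 2: "ord_ge ?P (s - ?q * sum \<alpha> UNIV) (B \<alpha>)" unfolding ord_ge_def
    proof (intro allI impI)
      fix i assume "i < s - ?q * sum \<alpha> UNIV"
      then have "i + ?q * sum \<alpha> UNIV < s" by simp
      from H[OF this] obtain z where
        z: "(\<Sum>v\<in>V. c v * int (jet_coeff ?u \<alpha> i v)) = int p * z" by (auto elim: dvdE)
      have "coeff (B \<alpha>) i = of_int (\<Sum>v\<in>V. c v * int (jet_coeff ?u \<alpha> i v))"
        unfolding B_def coeff_sum of_int_sum
      proof (rule sum.cong)
        fix v
        have "of_int (c v) * (of_nat (\<Prod>t\<in>UNIV. v t choose \<alpha> t) * [:1, 1:] ^ (\<Sum>t\<in>UNIV. ?u t * v t)) =
          smult (of_int (c v)) (smult (of_nat (\<Prod>t\<in>UNIV. v t choose \<alpha> t))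
            ([:1, 1:] ^ (\<Sum>t\<in>UNIV. ?u t * v t)) :: int poly poly)"
          unfolding Polynomial.of_int_poly of_nat_poly by (simp add: mult.commute)
        then show "coeff (of_int (c v) * (of_nat (\<Prod>t\<in>UNIV. v t choose \<alpha> t) *
            [:1, 1:] ^ (\<Sum>t\<in>UNIV. ?u t * v t)) :: int poly poly) i =
          of_int (c v * int (jet_coeff ?u \<alpha> i v))"
          by (simp add: coeff_one_plus_X_power jet_coeff_def)
      qed simp
      then show "?P dvd coeff (B \<alpha>) i" unfolding z by simp
    qed
    from ord_ge_mult[OF 1 2] show "ord_ge ?P s (D \<alpha> * B \<alpha>)" by (rule ord_ge_mono) simp
  qed
qed

text \<open>An integer polynomial that is nonzero modulo \<open>p\<close> is recovered, up to a factor of known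
  order, from its values on a grid of nodes; hence its jets cannot all vanish to high order.\<close>

lemma exists_jet_not_dvd:
  fixes c :: "('n::finite \<Rightarrow> nat) \<Rightarrow> int"
  assumes p: "prime p" and fin: "finite V" and v0: "v0 \<in> V" "\<not> int p dvd c v0"
    and deg: "\<And>v. v \<in> V \<Longrightarrow> (1 + l) * sum v UNIV < s"
  shows "\<exists>u \<alpha> i. (\<forall>t. \<not> p dvd u t) \<and> i + p ^ l * sum \<alpha> UNIV < s \<and>
           \<not> int p dvd (\<Sum>v\<in>V. c v * int (jet_coeff u \<alpha> i v))"
proof (rule ccontr)
  assume H: "\<not> ?thesis"
  then have H': "int p dvd (\<Sum>v\<in>V. c v * int (jet_coeff u \<alpha> i v))"
    if "\<And>t. \<not> p dvd u t" "i + p ^ l * sum \<alpha> UNIV < s" for u \<alpha> i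
    using that by meson
  let ?P = "of_nat p :: int poly"
  let ?X = "node p l"
  have pe: "prime_elem ?P" by (rule prime_elem_of_nat_int_poly[OF p])
  \<comment> \<open>\<open>m\<close> will have maximal degree among the exponents whose coefficients
    survive modulo \<open>p\<close>, so every other one is smaller than \<open>m\<close> in some
    coordinate.\<close>
  define V' where "V' = {v \<in> V. \<not> int p dvd c v}"
  have V': "finite V'" "V' \<noteq> {}" using fin v0 by (auto simp: V'_def)
  have "Max ((\<lambda>v. sum v UNIV) ` V') \<in> (\<lambda>v. sum v UNIV) ` V'" using V' by (intro Max_in) auto
  then obtain m where m: "m \<in> V'" "sum m UNIV = Max ((\<lambda>v. sum v UNIV) ` V')" by auto
  have mmax: "sum v UNIV \<le> sum m UNIV" if "v \<in> V'" for v
    using V' that by (simp add: m(2))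
  define F where "F g = (\<Sum>v\<in>V. of_int (c v) * (\<Prod>t\<in>UNIV. ?X (g t) ^ v t))" for g :: "'n \<Rightarrow> nat"
  have F: "ord_ge ?P s (F g)" for g
    unfolding F_def by (rule ord_ge_eval_at_nodes[OF fin], rule H') (auto simp: not_dvd_unit_node[OF p])
  define q where "q j i = (\<Sum>i'\<in>{..j} - {i}. node_ord p l i i')" for i j
  have qle: "q j i \<le> (1 + l) * j" if "i \<le> j" for i j
    unfolding q_def using sum_node_ord_le[OF p that] .
  have np: "ord_eq ?P (q j i) (node_prod ?X j i)" for i j
    unfolding q_def node_prod_def by (intro ord_eq_prod[OF pe] ord_eq_node_diff[OF p]) auto
  define T where "T j = (\<Sum>i\<le>j. q j i)" for j
  have cof: "ord_ge ?P (T j - (1 + l) * j) (node_cof ?X j i)" if "i \<le> j" for i j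
  proof -
    have "ord_ge ?P (\<Sum>i'\<in>{..j} - {i}. q j i') (node_cof ?X j i)"
      unfolding node_cof_def by (intro ord_ge_prod ord_eq_ge np)
    moreover have "T j = q j i + (\<Sum>i'\<in>{..j} - {i}. q j i')"
      unfolding T_def using that by (subst sum.remove[of _ i]) auto
    ultimately show ?thesis using qle[OF that] by (auto intro: ord_ge_mono)
  qed
  \<comment> \<open>A scaled divided difference of order \<open>m t\<close> in each coordinate
    isolates the coefficient at \<open>m\<close> modulo \<open>p\<close>. The values
    \<open>F g\<close> force \<open>S\<close> to have order above \<open>?T\<close>, while the
    surviving monomial gives order exactly \<open>?T\<close>.\<close>
  define I where "I = PiE UNIV (\<lambda>t. {..m t})"
  define S where "S = (\<Sum>g\<in>I. (\<Prod>t\<in>UNIV. node_cof ?X (m t) (g t)) * F g)"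
  let ?T = "\<Sum>t\<in>UNIV. T (m t)"
  have "ord_ge ?P (Suc ?T) S" unfolding S_def
  proof (rule ord_ge_sum)
    fix g assume "g \<in> I"
    then have g: "g t \<le> m t" for t by (auto simp: I_def PiE_iff)
    have "ord_ge ?P (\<Sum>t\<in>UNIV. T (m t) - (1 + l) * m t) (\<Prod>t\<in>UNIV. node_cof ?X (m t) (g t))"
      by (intro ord_ge_prod cof g)
    from ord_ge_mult[OF this F]
    have "ord_ge ?P ((\<Sum>t\<in>UNIV. T (m t) - (1 + l) * m t) + s)
            ((\<Prod>t\<in>UNIV. node_cof ?X (m t) (g t)) * F g)" .
    moreover have "?T \<le> (\<Sum>t\<in>UNIV. (T (m t) - (1 + l) * m t) + (1 + l) * m t)"
      by (rule sum_mono) simp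
    \<comment> \<open>The cofactors fall short of \<open>?T\<close> by at most
      \<open>(1 + l) * m t\<close> per coordinate and \<open>F g\<close> makes up \<open>s\<close>;
      strictness of \<open>deg\<close> supplies the extra one.\<close>
    then have "Suc ?T \<le> (\<Sum>t\<in>UNIV. T (m t) - (1 + l) * m t) + s"
      using deg[of m] m(1) by (simp add: sum.distrib V'_def flip: sum_distrib_left)
    ultimately show "ord_ge ?P (Suc ?T) ((\<Prod>t\<in>UNIV. node_cof ?X (m t) (g t)) * F g)"
      by (rule ord_ge_mono)
  qed
  define G where "G v = (\<Prod>t\<in>UNIV. \<Sum>i\<le>m t. node_cof ?X (m t) i * ?X i ^ v t)" for v :: "'n \<Rightarrow> nat"
  have "S = (\<Sum>v\<in>V. of_int (c v) * G v)"
  proof -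
    have "G v = (\<Sum>g\<in>I. \<Prod>t\<in>UNIV. node_cof ?X (m t) (g t) * ?X (g t) ^ v t)" for v
      unfolding G_def I_def by (rule prod_sum_PiE) auto
    then have "(\<Sum>v\<in>V. of_int (c v) * G v) =
      (\<Sum>v\<in>V. \<Sum>g\<in>I. (\<Prod>t\<in>UNIV. node_cof ?X (m t) (g t)) * (of_int (c v) * (\<Prod>t\<in>UNIV. ?X (g t) ^ v t)))"
      by (simp add: sum_distrib_left prod.distrib mult_ac)
    also have "\<dots> = S" unfolding S_def F_def by (subst sum.swap) (simp add: sum_distrib_left)
    finally show ?thesis by simp
  qed
  also have "\<dots> = of_int (c m) * G m + (\<Sum>v\<in>V - {m}. of_int (c v) * G v)"
    using fin m(1) by (subst sum.remove[of _ m]) (auto simp: V'_def)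
  finally have S: "S = of_int (c m) * G m + (\<Sum>v\<in>V - {m}. of_int (c v) * G v)" .
  have cz: "of_int z * h = smult (of_int z) h" for z and h :: "int poly poly"
    by (simp add: Polynomial.of_int_poly)
  have rest: "ord_ge ?P (Suc ?T) (\<Sum>v\<in>V - {m}. of_int (c v) * G v)"
  proof (rule ord_ge_sum)
    fix v assume v: "v \<in> V - {m}"
    show "ord_ge ?P (Suc ?T) (of_int (c v) * G v)"
    proof (cases "v \<in> V'")
      case False
      then obtain z where z: "c v = int p * z" using v by (auto simp: V'_def elim: dvdE)
      show ?thesis unfolding cz by (rule ord_ge_smult) (simp add: z)
    next
      case True
      have "\<exists>t. v t < m t"
      proof (rule ccontr)
        assume "\<nexists>t. v t < m t"
        then have ge: "m t \<le> v t" for t by (simp add: not_less)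
        obtain t where "m t \<noteq> v t" using v by (metis DiffD2 ext singletonI)
        then have "sum m UNIV < sum v UNIV" using ge
          by (intro sum_strict_mono_ex1) (auto simp: order.strict_iff_order)
        with mmax[OF True] show False by simp
      qed
      then obtain t where t: "v t < m t" ..
      have "(\<Sum>i\<le>m t. node_cof ?X (m t) i * ?X i ^ v t) = 0"
        using sum_node_cof_power[OF inj_node[OF p], of "v t" "m t"] t by simp
      then have "G v = 0" unfolding G_def by (intro prod_zero) auto
      then show ?thesis by simp
    qed
  qed
  have "G m = (\<Prod>t\<in>UNIV. \<Prod>i\<le>m t. node_prod ?X (m t) i)"
    unfolding G_def by (intro prod.cong) (auto simp: sum_node_cof_power[OF inj_node[OF p]])
  then have Gm: "ord_eq ?P ?T (G m)"
    unfolding T_def by (auto intro!: ord_eq_prod[OF pe] np)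
  have "\<not> ?P dvd of_int (c m)"
  proof
    assume "?P dvd of_int (c m)"
    then have "int p dvd coeff (of_int (c m) :: int poly) 0" by (simp only: of_nat_dvd_int_poly_iff)
    then show False using m(1) by (simp add: Polynomial.of_int_poly V'_def)
  qed
  then have "ord_eq ?P 0 [:of_int (c m):]" by (simp add: ord_eq_def)
  from ord_eq_mult[OF pe this Gm] have "ord_eq ?P ?T (of_int (c m) * G m)" by (simp add: cz)
  then have "ord_eq ?P ?T S" unfolding S by (rule ord_eq_add[OF _ rest]) simp
  with \<open>ord_ge ?P (Suc ?T) S\<close> show False using ord_eq_not_ge by blast
qed

text \<open>Greedy choice. The jets found so far are fewer than the monomials up to the next one, so
  some integer combination of these monomials, nonzero modulo \<open>p\<close>, is killed by all of
  them, and \<open>exists_jet_not_dvd\<close> supplies a jet that does not kill it. Sorting by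
  degree lets the newest monomial bound the level of that jet.\<close>

lemma triangular_jets:
  fixes xs :: "('n::finite \<Rightarrow> nat) list"
  assumes p: "prime p" and V: "finite V"
    and xs: "distinct xs" "sorted (map (\<lambda>v. sum v UNIV) xs)" "set xs \<subseteq> V"
  shows "\<exists>u \<alpha> i f. \<forall>j<length xs. (\<forall>t. \<not> p dvd u j t) \<and>
           i j + p ^ l * sum (\<alpha> j) UNIV \<le> (1 + l) * sum (xs ! j) UNIV \<and>
           \<not> int p dvd (\<Sum>v\<in>V. f j v * int (jet_coeff (u j) (\<alpha> j) (i j) v)) \<and>
           (\<forall>j'<j. (\<Sum>v\<in>V. f j v * int (jet_coeff (u j') (\<alpha> j') (i j') v)) = 0)"
  using xs
proof (induction xs rule: rev_induct)
  case Nil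
  show ?case by simp
next
  case (snoc x xs)
  let ?n = "length xs"
  let ?K = "set (xs @ [x])"
  have K: "finite ?K" "card ?K = Suc ?n" "?K \<subseteq> V"
    using snoc.prems distinct_card[OF snoc.prems(1)] by auto
  from snoc obtain u \<alpha> i and f :: "nat \<Rightarrow> ('n \<Rightarrow> nat) \<Rightarrow> int" where IH:
    "\<And>j. j < ?n \<Longrightarrow> (\<forall>t. \<not> p dvd u j t) \<and>
           i j + p ^ l * sum (\<alpha> j) UNIV \<le> (1 + l) * sum (xs ! j) UNIV \<and>
           \<not> int p dvd (\<Sum>v\<in>V. f j v * int (jet_coeff (u j) (\<alpha> j) (i j) v)) \<and>
           (\<forall>j'<j. (\<Sum>v\<in>V. f j v * int (jet_coeff (u j') (\<alpha> j') (i j') v)) = 0)"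
    by (auto simp: sorted_append)
  have "int p > 1" using prime_gt_1_nat[OF p] by simp
  from underdetermined_system_solvable_not_dvd[OF finite_lessThan[of ?n] K(1) _ this,
      of "\<lambda>e v. int (jet_coeff (u e) (\<alpha> e) (i e) v)"] K(2)
  obtain c where c: "\<exists>v\<in>?K. \<not> int p dvd c v"
    "\<And>e. e < ?n \<Longrightarrow> (\<Sum>v\<in>?K. int (jet_coeff (u e) (\<alpha> e) (i e) v) * c v) = 0" by auto
  define g where "g v = (if v \<in> ?K then c v else 0)" for v
  have g: "(\<Sum>v\<in>V. g v * h v) = (\<Sum>v\<in>?K. c v * h v)" for h
    by (rule sum.mono_neutral_cong_right) (use V K in \<open>auto simp: g_def\<close>)
  from c(1) obtain v0 where v0: "v0 \<in> ?K" "\<not> int p dvd c v0" by blast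
  have deg: "(1 + l) * sum v UNIV < Suc ((1 + l) * sum x UNIV)" if "v \<in> ?K" for v
  proof -
    have "sum v UNIV \<le> sum x UNIV" using that snoc.prems(2) by (auto simp: sorted_append)
    then show ?thesis by (simp add: less_Suc_eq_le mult_le_mono del: mult_Suc)
  qed
  from exists_jet_not_dvd[where c = c and l = l and s = "Suc ((1 + l) * sum x UNIV)", OF p K(1) v0 deg] obtain u' \<alpha>' i' where
    new: "\<And>t. \<not> p dvd u' t" "i' + p ^ l * sum \<alpha>' UNIV \<le> (1 + l) * sum x UNIV"
      "\<not> int p dvd (\<Sum>v\<in>?K. c v * int (jet_coeff u' \<alpha>' i' v))"
    by (auto simp: less_Suc_eq_le)
  have c2: "(\<Sum>v\<in>V. g v * int (jet_coeff (u e) (\<alpha> e) (i e) v)) = 0" if "e < ?n" for e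
    unfolding g using c(2)[OF that] by (simp add: mult.commute)
  show ?case
  proof (rule exI[of _ "u(?n := u')"], rule exI[of _ "\<alpha>(?n := \<alpha>')"], rule exI[of _ "i(?n := i')"],
      rule exI[of _ "f(?n := g)"], intro allI impI)
    fix j assume "j < length (xs @ [x])"
    then consider "j < ?n" | "j = ?n" by fastforce
    then show "(\<forall>t. \<not> p dvd (u(?n := u')) j t) \<and>
           (i(?n := i')) j + p ^ l * sum ((\<alpha>(?n := \<alpha>')) j) UNIV \<le> (1 + l) * sum ((xs @ [x]) ! j) UNIV \<and>
           \<not> int p dvd (\<Sum>v\<in>V. (f(?n := g)) j v *
              int (jet_coeff ((u(?n := u')) j) ((\<alpha>(?n := \<alpha>')) j) ((i(?n := i')) j) v)) \<and>
           (\<forall>j'<j. (\<Sum>v\<in>V. (f(?n := g)) j v *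
              int (jet_coeff ((u(?n := u')) j') ((\<alpha>(?n := \<alpha>')) j') ((i(?n := i')) j') v)) = 0)"
    proof cases
      case 1
      then show ?thesis using IH[OF 1] by (simp add: nth_append)
    next
      case 2
      then show ?thesis using new c2 by (simp add: nth_append g)
    qed
  qed
qed

section \<open>Jets as polynomial functions of the exponent vector\<close>

text \<open>The span of the power products of degree at most \<open>D\<close>, which are the
  eigenvalues of Euler operators on monomials. As an inductive predicate it carries annihilation
  from power products to jets by rule induction.\<close>

inductive coord_poly :: "nat \<Rightarrow> (('n::finite \<Rightarrow> nat) \<Rightarrow> complex) \<Rightarrow> bool" where
  monomial: "sum \<beta> UNIV \<le> D \<Longrightarrow> coord_poly D (\<lambda>v. \<Prod>t\<in>UNIV. of_nat (v t) ^ \<beta> t)"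
| add: "coord_poly D \<phi> \<Longrightarrow> coord_poly D \<psi> \<Longrightarrow> coord_poly D (\<lambda>v. \<phi> v + \<psi> v)"
| scale: "coord_poly D \<phi> \<Longrightarrow> coord_poly D (\<lambda>v. c * \<phi> v)"

lemma coord_poly_mono: "coord_poly D \<phi> \<Longrightarrow> D \<le> D' \<Longrightarrow> coord_poly D' \<phi>"
  by (induction rule: coord_poly.induct) (auto intro: coord_poly.intros)

lemma coord_poly_1: "coord_poly 0 (\<lambda>_. 1)"
  using coord_poly.monomial[of "\<lambda>_. 0" 0] by simp

lemma coord_poly_mult_coord:
  "coord_poly D \<phi> \<Longrightarrow> coord_poly (Suc D) (\<lambda>v. of_nat (v t) * \<phi> v)"
proof (induction rule: coord_poly.induct)
  case (monomial \<beta> D)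
  have "sum (\<beta>(t := Suc (\<beta> t))) UNIV = Suc (sum \<beta> UNIV)"
    by (subst (1 2) sum.remove[of UNIV t]) auto
  then have "coord_poly (Suc D) (\<lambda>v. \<Prod>s\<in>UNIV. of_nat (v s) ^ (\<beta>(t := Suc (\<beta> t))) s)"
    using monomial by (intro coord_poly.monomial) simp
  moreover have "(\<Prod>s\<in>UNIV. complex_of_nat (v s) ^ (\<beta>(t := Suc (\<beta> t))) s) =
      of_nat (v t) * (\<Prod>s\<in>UNIV. of_nat (v s) ^ \<beta> s)" for v :: "'a \<Rightarrow> nat"
    by (subst (1 2) prod.remove[of UNIV t]) (auto simp: mult.assoc)
  ultimately show ?case by simp
next
  case (add D \<phi> \<psi>)
  from coord_poly.add[OF add.IH] show ?case by (simp add: algebra_simps)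
next
  case (scale D \<phi> c)
  from coord_poly.scale[OF scale.IH, of c] show ?case by (simp add: mult_ac)
qed

lemma coord_poly_mult_linear:
  assumes "coord_poly D \<phi>"
  shows "coord_poly (Suc D) (\<lambda>v. of_nat (\<Sum>t\<in>UNIV. u t * v t) * \<phi> v)"
proof -
  have "coord_poly (Suc D) (\<lambda>v. of_nat (\<Sum>t\<in>A. u t * v t) * \<phi> v)" for A
  proof (induction A rule: infinite_finite_induct)
    case empty
    from coord_poly.scale[OF coord_poly_mono[OF assms, of "Suc D"], of 0] show ?case by simp
  next
    case (insert t A)
    from coord_poly.add[OF coord_poly.scale[OF coord_poly_mult_coord[OF assms, of t], of "of_nat (u t)"]
        insert.IH] insert.hyps
    show ?case by (simp add: algebra_simps)
  qed simp
  then show ?thesis .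
qed

lemma coord_poly_mult_binomial:
  assumes h: "\<And>D \<phi>. coord_poly D \<phi> \<Longrightarrow> coord_poly (Suc D) (\<lambda>v. of_nat (h v) * \<phi> v)"
    and \<phi>: "coord_poly D \<phi>"
  shows "coord_poly (D + j) (\<lambda>v. of_nat (h v choose j) * \<phi> v)"
proof (induction j)
  case (Suc j)
  have "complex_of_nat (w choose Suc j) =
      (1 / of_nat (Suc j)) * (of_nat w * of_nat (w choose j)) +
      (- of_nat j / of_nat (Suc j)) * of_nat (w choose j)" for w
    using gbinomial_mult_1[of "complex_of_nat w" j]
    by (simp add: binomial_gbinomial field_simps del: of_nat_Suc)
  then have eq: "complex_of_nat (w choose Suc j) * y =
      (1 / of_nat (Suc j)) * (of_nat w * (of_nat (w choose j) * y)) +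
      (- of_nat j / of_nat (Suc j)) * (of_nat (w choose j) * y)" for w y
    by (simp only: distrib_right mult.assoc)
  show ?case unfolding eq add_Suc_right
    by (intro coord_poly.add coord_poly.scale h Suc.IH coord_poly_mono[OF Suc.IH]) simp
qed (use \<phi> in simp)

text \<open>Hence a Taylor coefficient of total order \<open>sum \<alpha> UNIV + j\<close> along a
  curve through a point is controlled by vanishing at that point to any higher order.\<close>

lemma coord_poly_jet_coeff: "coord_poly (sum \<alpha> UNIV + j) (\<lambda>v. of_nat (jet_coeff u \<alpha> j v))"
proof -
  have "coord_poly (sum \<alpha> A) (\<lambda>v. of_nat (\<Prod>t\<in>A. v t choose \<alpha> t))" for A
  proof (induction A rule: infinite_finite_induct)
    case (insert t A)
    from coord_poly_mult_binomial[where h = "\<lambda>v. v t" and j = "\<alpha> t",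
        OF coord_poly_mult_coord insert.IH] insert.hyps
    show ?case by (simp add: add.commute)
  qed (use coord_poly_1 in simp_all)
  from coord_poly_mult_binomial[where h = "\<lambda>v. \<Sum>t\<in>UNIV. u t * v t" and j = j,
      OF coord_poly_mult_linear this]
  show ?thesis by (simp add: jet_coeff_def mult.commute)
qed

lemma coord_poly_annihilated:
  assumes "coord_poly D \<phi>" "D < F"
    and "\<And>\<beta>. sum \<beta> UNIV < F \<Longrightarrow> (\<Sum>v\<in>V. c v * (\<Prod>t\<in>UNIV. of_nat (v t) ^ \<beta> t)) = 0"
  shows "(\<Sum>v\<in>V. c v * \<phi> v) = 0"
  using assms
proof (induction rule: coord_poly.induct)
  case (add D \<phi> \<psi>)
  then show ?case by (simp add: distrib_left sum.distrib)
next
  case (scale D \<phi> c')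
  have "(\<Sum>v\<in>V. c v * (c' * \<phi> v)) = c' * (\<Sum>v\<in>V. c v * \<phi> v)"
    by (simp add: sum_distrib_left mult_ac)
  then show ?case using scale by simp
qed auto

subsection \<open>Lifting to characteristic zero\<close>

lemma prod_linear_powers_dvd:
  fixes a :: "'i \<Rightarrow> 'a::idom"
  assumes "finite A" "inj_on a A" "\<And>i. i \<in> A \<Longrightarrow> [:- a i, 1:] ^ m i dvd G"
  shows "(\<Prod>i\<in>A. [:- a i, 1:] ^ m i) dvd G"
proof (cases "G = 0")
  case False
  show ?thesis using assms
  proof (induction A rule: finite_induct)
    case (insert i A)
    let ?P = "\<Prod>i\<in>A. [:- a i, 1:] ^ m i"
    have "?P dvd G" using insert by (auto simp: inj_on_insert)
    then obtain H where H: "G = ?P * H" ..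
    have "poly ?P (a i) = (\<Prod>j\<in>A. (a i - a j) ^ m j)" by (simp add: poly_prod)
    moreover have "a i \<noteq> a j" if "j \<in> A" for j
      using insert.prems(1) insert.hyps(2) that by (auto simp: inj_on_def)
    ultimately have "poly ?P (a i) \<noteq> 0" using insert.hyps(1) by simp
    then have "Polynomial.order (a i) ?P = 0" by (rule order_0I)
    then have "Polynomial.order (a i) G = Polynomial.order (a i) H" using False order_mult[of ?P H "a i"] by (simp flip: H)
    then have "[:- a i, 1:] ^ m i dvd H"
      using insert.prems(2)[of i] False by (simp add: order_divides)
    then have "[:- a i, 1:] ^ m i * ?P dvd H * ?P" by (rule mult_dvd_mono) simp
    then show ?case using insert.hyps H by (simp add: mult.commute)
  qed simp
qed simp

text \<open>\<open>[:z - 1, z:]\<close> substitutes \<open>z * (1 + \<tau>)\<close> for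
  \<open>1 + \<tau>\<close>, which moves the point \<open>z - 1\<close> to the origin;
  \<open>?l\<close> is the inverse substitution.\<close>

lemma linear_power_dvd_if_shifted_coeffs_zero:
  fixes G :: "complex poly"
  assumes z: "z \<noteq> 0" and c: "\<And>j. j < M \<Longrightarrow> coeff (pcompose G [:z - 1, z:]) j = 0"
  shows "[:1 - z, 1:] ^ M dvd G"
proof -
  let ?l = "[:(1 - z) / z, 1 / z:]"
  have "monom 1 M dvd pcompose G [:z - 1, z:]" using c by (simp add: monom_1_dvd_iff')
  then obtain h where "pcompose G [:z - 1, z:] = monom 1 M * h" ..
  then have "pcompose (pcompose G [:z - 1, z:]) ?l = pcompose ([:0, 1:] ^ M * h) ?l"
    by (simp add: monom_altdef)
  also have "pcompose (pcompose G [:z - 1, z:]) ?l = G"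
    using z by (subst pcompose_assoc[symmetric]) (simp add: pcompose_pCons field_simps)
  also have "pcompose ([:0, 1:] ^ M * h) ?l = ?l ^ M * pcompose h ?l"
    by (simp add: pcompose_mult pcompose_hom.hom_power pcompose_pCons)
  also have "?l ^ M = smult ((1 / z) ^ M) ([:1 - z, 1:] ^ M)" by (simp flip: smult_power)
  finally have "G = [:1 - z, 1:] ^ M * smult ((1 / z) ^ M) (pcompose h ?l)" by simp
  then show ?thesis by (rule dvdI)
qed

text \<open>Vanishing of \<open>g\<close>, viewed as a polynomial with coefficients \<open>g v\<close>, to order \<open>F x\<close> at every
  point \<open>\<zeta> ^ x\<close> is expressed through Euler operators, which act diagonally on monomials.\<close>

lemma roots_product_dvd_restriction:
  fixes g :: "('n::finite \<Rightarrow> nat) \<Rightarrow> complex"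
  assumes z: "z \<noteq> 0" "inj_on (\<lambda>r. z ^ r) {..<q}"
    and g: "\<And>x \<beta>. sum \<beta> UNIV < F x \<Longrightarrow>
      (\<Sum>v\<in>V. g v * z ^ (\<Sum>t\<in>UNIV. x t * v t) * (\<Prod>t\<in>UNIV. of_nat (v t) ^ \<beta> t)) = 0"
  shows "(\<Prod>r<q. [:1 - z ^ r, 1:] ^ (F (\<lambda>t. a t + r * u t) - sum \<alpha> UNIV)) dvd
    (\<Sum>v\<in>V. smult (g v * z ^ (\<Sum>t\<in>UNIV. a t * v t) * of_nat (\<Prod>t\<in>UNIV. v t choose \<alpha> t))
      ([:1, 1:] ^ (\<Sum>t\<in>UNIV. u t * v t)))"
    (is "_ dvd ?G")
proof -
  let ?m = "\<lambda>r. F (\<lambda>t. a t + r * u t) - sum \<alpha> UNIV"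
  have "(\<Prod>r<q. [:- (z ^ r - 1), 1:] ^ ?m r) dvd ?G"
  proof (rule prod_linear_powers_dvd)
    show "inj_on (\<lambda>r. z ^ r - 1) {..<q}" using z(2) by (auto simp: inj_on_def)
  next
    fix r assume "r \<in> {..<q}"
    \<comment> \<open>At \<open>1 + \<tau> = z ^ r\<close> the curve passes through the point with
      exponents \<open>?x\<close>; the transversal derivatives lower the order there by
      \<open>sum \<alpha> UNIV\<close>.\<close>
    let ?x = "\<lambda>t. a t + r * u t"
    have "[:1 - z ^ r, 1:] ^ (F ?x - sum \<alpha> UNIV) dvd ?G"
    proof (rule linear_power_dvd_if_shifted_coeffs_zero)
      fix j assume j: "j < F ?x - sum \<alpha> UNIV"
      have lin: "pcompose [:1, 1:] [:z ^ r - 1, z ^ r:] = smult (z ^ r) [:1, 1:]"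
        by (simp add: pcompose_pCons)
      have "pcompose ?G [:z ^ r - 1, z ^ r:] =
        (\<Sum>v\<in>V. smult (g v * z ^ (\<Sum>t\<in>UNIV. a t * v t) * of_nat (\<Prod>t\<in>UNIV. v t choose \<alpha> t))
          (smult ((z ^ r) ^ (\<Sum>t\<in>UNIV. u t * v t)) ([:1, 1:] ^ (\<Sum>t\<in>UNIV. u t * v t))))"
        unfolding pcompose_sum
        by (intro sum.cong refl) (simp only: pcompose_smult pcompose_hom.hom_power lin smult_power)
      moreover have "(\<Sum>t\<in>UNIV. ?x t * v t) = (\<Sum>t\<in>UNIV. a t * v t) + r * (\<Sum>t\<in>UNIV. u t * v t)" for v
        by (simp add: sum.distrib distrib_right sum_distrib_left mult.assoc)
      ultimately have "coeff (pcompose ?G [:z ^ r - 1, z ^ r:]) j =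
        (\<Sum>v\<in>V. g v * z ^ (\<Sum>t\<in>UNIV. ?x t * v t) * of_nat (jet_coeff u \<alpha> j v))"
        by (simp add: coeff_sum coeff_one_plus_X_power jet_coeff_def power_add power_mult mult_ac)
      also have "\<dots> = 0"
        using j by (intro coord_poly_annihilated[OF coord_poly_jet_coeff _ g]) auto
      finally show "coeff (pcompose ?G [:z ^ r - 1, z ^ r:]) j = 0" .
    qed (use z in simp)
    then show "[:- (z ^ r - 1), 1:] ^ ?m r dvd ?G" by simp
  qed simp
  then show ?thesis by simp
qed

section \<open>Division by the polynomial of the prescribed zeros along a curve\<close>

text \<open>The inner variable stands for the root of unity \<open>\<zeta>\<close>, so one integral
  object specialises both to \<open>\<zeta>\<close> and to \<open>1\<close>. Its zeros lie at
  \<open>1 + \<tau> = \<zeta> ^ r\<close>, with multiplicity \<open>M r\<close>.\<close>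

definition line_poly :: "nat \<Rightarrow> (nat \<Rightarrow> nat) \<Rightarrow> int poly poly" where
  "line_poly q M = (\<Prod>r<q. [:1 - monom 1 r, 1:] ^ M r)"

lemma monic_line_poly: "lead_coeff (line_poly q M) = 1"
  unfolding line_poly_def lead_coeff_prod lead_coeff_power by simp

lemma degree_line_poly: "degree (line_poly q M) = (\<Sum>r<q. M r)"
  unfolding line_poly_def by (subst degree_prod_eq_sum_degree) (auto simp: degree_power_eq)

definition line_rem :: "nat \<Rightarrow> (nat \<Rightarrow> nat) \<Rightarrow> nat \<Rightarrow> int poly poly" where
  "line_rem q M w = (SOME r. (r = 0 \<or> degree r < (\<Sum>r<q. M r)) \<and>
     (\<exists>Q. [:1, 1:] ^ w = Q * line_poly q M + r))"

lemma line_rem: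
  "line_rem q M w = 0 \<or> degree (line_rem q M w) < (\<Sum>r<q. M r)"
  "\<exists>Q. [:1, 1:] ^ w = Q * line_poly q M + line_rem q M w"
proof -
  obtain Q R where "[:1, 1:] ^ w = Q * line_poly q M + R" "R = 0 \<or> degree R < degree (line_poly q M)"
    using monic_division[OF monic_line_poly] by metis
  then have "\<exists>r. (r = 0 \<or> degree r < (\<Sum>r<q. M r)) \<and> (\<exists>Q. [:1, 1:] ^ w = Q * line_poly q M + r)"
    by (auto simp: degree_line_poly)
  from someI_ex[OF this] show
    "line_rem q M w = 0 \<or> degree (line_rem q M w) < (\<Sum>r<q. M r)"
    "\<exists>Q. [:1, 1:] ^ w = Q * line_poly q M + line_rem q M w"
    by (auto simp: line_rem_def)
qed

lemma map_poly_line_rem: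
  fixes h :: "int poly \<Rightarrow> 'b::comm_ring_1"
  assumes "comm_ring_hom h"
  shows "\<exists>Q. [:1, 1:] ^ w = Q * (\<Prod>r<q. [:1 - h (monom 1 1) ^ r, 1:] ^ M r) + map_poly h (line_rem q M w)"
proof -
  interpret h: comm_ring_hom h by (rule assms)
  interpret mh: map_poly_comm_ring_hom h ..
  obtain Q where Q: "[:1, 1:] ^ w = Q * line_poly q M + line_rem q M w" using line_rem(2) by blast
  have X: "monom 1 r = (monom 1 1 :: int poly) ^ r" for r by (simp add: monom_power)
  have l: "map_poly h [:1 - monom 1 r, 1:] = [:1 - h (monom 1 1) ^ r, 1:]" for r
    unfolding X[of r]
    by (rule poly_eqI) (simp add: coeff_map_poly coeff_pCons h.hom_minus h.hom_power split: nat.splits)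
  have "map_poly h ([:1, 1:] ^ w) = map_poly h Q * map_poly h (line_poly q M) + map_poly h (line_rem q M w)"
    unfolding Q by (simp add: mh.hom_add mh.hom_mult)
  moreover have "map_poly h (line_poly q M) = (\<Prod>r<q. [:1 - h (monom 1 1) ^ r, 1:] ^ M r)"
    unfolding line_poly_def mh.hom_prod mh.hom_power l ..
  moreover have "map_poly h ([:1, 1:] ^ w) = [:1, 1:] ^ w" by (simp add: mh.hom_power)
  ultimately show ?thesis by metis
qed

lemma finite_simplex: "finite {\<beta> :: 'n::finite \<Rightarrow> nat. sum \<beta> UNIV < M}"
proof (rule finite_subset)
  have "\<beta> t < M" if "sum \<beta> UNIV < M" for \<beta> :: "'n \<Rightarrow> nat" and t
    using that member_le_sum[of t UNIV \<beta>] by auto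
  then show "{\<beta> :: 'n \<Rightarrow> nat. sum \<beta> UNIV < M} \<subseteq> PiE UNIV (\<lambda>_. {..<M})" by auto
qed (auto intro: finite_PiE)

lemma comm_ring_hom_poly_1: "comm_ring_hom (\<lambda>g :: int poly. poly g 1)"
  by unfold_locales auto

lemma comm_ring_hom_poly_complex: "comm_ring_hom (\<lambda>g. poly (of_int_poly g) (z::complex))"
  by unfold_locales (auto simp: hom_distribs)

lemma line_rem_at_1:
  assumes "i < (\<Sum>r<q. M r)"
  shows "poly (coeff (line_rem q M w) i) 1 = int (w choose i)"
proof -
  interpret h: comm_ring_hom "\<lambda>g :: int poly. poly g 1" by (rule comm_ring_hom_poly_1)
  obtain Q where Q: "([:1, 1:] :: int poly) ^ w =
      Q * (\<Prod>r<q. [:1 - poly (monom 1 1) 1 ^ r, 1:] ^ M r) + map_poly (\<lambda>g. poly g 1) (line_rem q M w)"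
    using map_poly_line_rem[OF comm_ring_hom_poly_1] by blast
  have "(\<Prod>r<q. [:1 - poly (monom 1 1) (1::int) ^ r, 1:] ^ M r) = monom 1 (\<Sum>r<q. M r)"
    by (simp add: poly_monom monom_altdef power_sum)
  then have "coeff ([:1, 1:] ^ w :: int poly) i = poly (coeff (line_rem q M w) i) 1"
    unfolding Q using assms by (simp add: coeff_map_poly mult.commute[of Q] coeff_monom_mult)
  then show ?thesis by (simp add: coeff_one_plus_X_power)
qed

text \<open>The combined remainder is divisible by the product and of smaller degree, hence zero.
  Each remainder coefficient is thus a linear functional that the vanishing conditions force to
  zero.\<close>

lemma line_rem_combination_eq_0:
  fixes z :: complex and K :: "'v \<Rightarrow> complex"
  defines "h \<equiv> \<lambda>g. poly (of_int_poly g) z"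
  assumes dv: "(\<Prod>r<q. [:1 - z ^ r, 1:] ^ M r) dvd (\<Sum>v\<in>V. smult (K v) ([:1, 1:] ^ w v))"
  shows "(\<Sum>v\<in>V. K v * h (coeff (line_rem q M (w v)) i)) = 0"
proof -
  let ?O = "\<Prod>r<q. [:1 - z ^ r, 1:] ^ M r"
  let ?R = "\<Sum>v\<in>V. smult (K v) (map_poly h (line_rem q M (w v)))"
  have hom: "comm_ring_hom h" unfolding h_def by (rule comm_ring_hom_poly_complex)
  then interpret h: comm_ring_hom h .
  have hX: "h (monom 1 1) = z" by (simp add: h_def hom_distribs poly_monom)
  have "\<exists>Q. [:1, 1:] ^ w v = Q * ?O + map_poly h (line_rem q M (w v))" for v
    using map_poly_line_rem[OF hom, where w = "w v" and q = q and M = M] unfolding hX .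
  then obtain Q where Q: "[:1, 1:] ^ w v = Q v * ?O + map_poly h (line_rem q M (w v))" for v
    by metis
  have dO: "degree ?O = (\<Sum>r<q. M r)"
    by (subst degree_prod_eq_sum_degree) (auto simp: degree_power_eq)
  have split: "(\<Sum>v\<in>V. smult (K v) ([:1, 1:] ^ w v)) = ?O * (\<Sum>v\<in>V. smult (K v) (Q v)) + ?R"
    unfolding Q sum_distrib_left by (simp add: smult_add_right sum.distrib mult.commute)
  have dR: "?O dvd ?R" using dv unfolding split by (simp only: dvd_add_right_iff[OF dvd_triv_left])
  have deg: "?R = 0 \<or> degree ?R < (\<Sum>r<q. M r)"
  proof (cases "(\<Sum>r<q. M r) = 0")
    case True
    then have "line_rem q M (w v) = 0" for v using line_rem(1)[of q M "w v"] by simp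
    then show ?thesis by simp
  next
    case False
    have "degree (smult (K v) (map_poly h (line_rem q M (w v)))) \<le> (\<Sum>r<q. M r) - 1" for v
    proof -
      have "degree (smult (K v) (map_poly h (line_rem q M (w v)))) \<le> degree (line_rem q M (w v))"
        using degree_smult_le degree_map_poly_le order.trans by blast
      also have "\<dots> \<le> (\<Sum>r<q. M r) - 1" using line_rem(1)[of q M "w v"] False by auto
      finally show ?thesis .
    qed
    then have "degree ?R \<le> (\<Sum>r<q. M r) - 1" by (cases "finite V") (auto intro: degree_sum_le)
    with False show ?thesis by linarith
  qed
  have "?R = 0" using dvd_imp_degree_le[OF dR] deg unfolding dO by linarith
  then have "coeff ?R i = 0" by simp
  then show ?thesis by (simp add: coeff_sum coeff_map_poly)
qed

text \<open>Lifting jets from characteristic \<open>p\<close> to characteristic \<open>0\<close> replaces an \<open>i\<close>-th Taylor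
  coefficient along a direction by a coefficient of the remainder modulo the polynomial
  \<open>line_poly\<close>, which collapses to a power of the variable when the root of unity becomes \<open>1\<close>.\<close>

lemma triangular_jets_length_le:
  fixes u \<alpha> a :: "nat \<Rightarrow> 'n::finite \<Rightarrow> nat" and f :: "nat \<Rightarrow> ('n \<Rightarrow> nat) \<Rightarrow> int"
  assumes p: "prime p" and k: "k \<ge> 1"
    and diag: "\<And>j. j < N \<Longrightarrow> \<not> int p dvd (\<Sum>v\<in>V. f j v * int (jet_coeff (u j) (\<alpha> j) (i j) v))"
    and tri: "\<And>j j'. j < N \<Longrightarrow> j' < j \<Longrightarrow>
                (\<Sum>v\<in>V. f j v * int (jet_coeff (u j') (\<alpha> j') (i j') v)) = 0"
    and per: "\<And>x. F (\<lambda>t. x t mod p ^ k) = F x"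
    and line: "\<And>j. j < N \<Longrightarrow> i j < (\<Sum>r<p ^ k. F (\<lambda>t. a j t + r * u j t) - sum (\<alpha> j) UNIV)"
  shows "N \<le> (\<Sum>x\<in>PiE UNIV (\<lambda>_. {..<p ^ k}). card {\<beta> :: 'n \<Rightarrow> nat. sum \<beta> UNIV < F x})"
proof (rule ccontr)
  assume neg: "\<not> ?thesis"
  let ?q = "p ^ k"
  let ?X = "PiE UNIV (\<lambda>_. {..<?q}) :: ('n \<Rightarrow> nat) set"
  define M where "M j r = F (\<lambda>t. a j t + r * u j t) - sum (\<alpha> j) UNIV" for j r
  \<comment> \<open>Row \<open>j'\<close> is a functional, column \<open>j\<close> a polynomial. At
    \<open>1\<close> the entry is a jet; at a root of unity it is a coefficient of the remainder of
    the polynomial restricted to the curve \<open>j'\<close>.\<close>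
  define en where "en j' j = (\<Sum>v\<in>V. of_int (f j v) * (monom 1 (\<Sum>t\<in>UNIV. a j' t * v t) *
      of_nat (\<Prod>t\<in>UNIV. v t choose \<alpha> j' t) *
      coeff (line_rem ?q (M j') (\<Sum>t\<in>UNIV. u j' t * v t)) (i j')))" for j' j
  define A where "A = Matrix.mat N N (\<lambda>(r, c). en r c)"
  have A: "A \<in> carrier_mat N N" by (simp add: A_def)
  have en1: "poly (en j' j) 1 = (\<Sum>v\<in>V. f j v * int (jet_coeff (u j') (\<alpha> j') (i j') v))"
    if "j' < N" for j j'
    unfolding en_def poly_sum
    using line_rem_at_1[where i = "i j'" and q = ?q and M = "M j'"] line[OF that]
    by (intro sum.cong) (auto simp: poly_monom jet_coeff_def M_def poly_prod)
  interpret h1: comm_ring_hom "\<lambda>g :: int poly. poly g 1" by (rule comm_ring_hom_poly_1)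
  have A1: "map_mat (\<lambda>g. poly g 1) A \<in> carrier_mat N N" using A by simp
  have "poly (Determinant.det A) 1 = Determinant.det (map_mat (\<lambda>g. poly g 1) A)"
    by (rule comm_ring_hom.hom_det[OF comm_ring_hom_poly_1, symmetric])
  also have "\<dots> = prod_list (diag_mat (map_mat (\<lambda>g. poly g 1) A))"
    by (rule det_lower_triangular[OF _ A1]) (simp add: A_def en1 tri)
  also have "\<dots> = (\<Prod>j = 0..<N. \<Sum>v\<in>V. f j v * int (jet_coeff (u j) (\<alpha> j) (i j) v))"
    unfolding prod_list_diag_prod using A by (intro prod.cong) (auto simp: A_def en1)
  finally have det1: "\<not> int p dvd poly (Determinant.det A) 1"
    using diag p by (auto simp: prime_dvd_prod_iff)
  have "int p dvd poly (Determinant.det A) 1"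
  proof (rule dvd_poly_1_if_vanishes_on_primitive_roots[OF p k])
    fix z :: complex assume z: "z ^ ?q = 1" "inj_on (\<lambda>t. z ^ t) {..<?q}"
    have z0: "z \<noteq> 0" using z(1) p by (auto simp: power_0_left prime_gt_0_nat split: if_splits)
    define h where "h = (\<lambda>g. poly (of_int_poly g) z)"
    interpret h: comm_ring_hom h unfolding h_def by (rule comm_ring_hom_poly_complex)
    define E where "E = Sigma ?X (\<lambda>x. {\<beta> :: 'n \<Rightarrow> nat. sum \<beta> UNIV < F x})"
    have fX: "finite ?X" by (auto intro: finite_PiE)
    have finE: "finite E" unfolding E_def using fX by (intro finite_SigmaI finite_simplex) auto
    \<comment> \<open>There are more polynomials than vanishing conditions, so some nontrivial
      combination \<open>g\<close> meets all of them; its coefficients \<open>c\<close> form a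
      kernel vector of the specialised matrix.\<close>
    have "card E < card {..<N}" using neg fX by (simp add: E_def card_SigmaI finite_simplex)
    from underdetermined_system_solvable[OF finE finite_lessThan this,
        of "\<lambda>e j. \<Sum>v\<in>V. of_int (f j v) * (z ^ (\<Sum>t\<in>UNIV. fst e t * v t) *
               (\<Prod>t\<in>UNIV. of_nat (v t) ^ snd e t))"]
    obtain c where c: "\<exists>j<N. c j \<noteq> 0" and cE: "\<And>x \<beta>. (x, \<beta>) \<in> E \<Longrightarrow>
        (\<Sum>j<N. (\<Sum>v\<in>V. of_int (f j v) * (z ^ (\<Sum>t\<in>UNIV. x t * v t) *
               (\<Prod>t\<in>UNIV. of_nat (v t) ^ \<beta> t))) * c j) = 0" by fastforce
    define g where "g v = (\<Sum>j<N. c j * of_int (f j v))" for v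
    have gsum: "(\<Sum>v\<in>V. g v * y v) = (\<Sum>j<N. (\<Sum>v\<in>V. of_int (f j v) * y v) * c j)" for y
      unfolding g_def by (subst sum_distrib_right, subst sum.swap) (simp add: sum_distrib_left mult_ac)
    have gE: "(\<Sum>v\<in>V. g v * z ^ (\<Sum>t\<in>UNIV. x t * v t) * (\<Prod>t\<in>UNIV. of_nat (v t) ^ \<beta> t)) = 0"
      if "sum \<beta> UNIV < F x" for x \<beta>
    proof -
      let ?x = "\<lambda>t. x t mod ?q"
      have "(?x, \<beta>) \<in> E" using that p by (auto simp: E_def per prime_gt_0_nat)
      from cE[OF this] have "(\<Sum>v\<in>V. g v * (z ^ (\<Sum>t\<in>UNIV. ?x t * v t) * (\<Prod>t\<in>UNIV. of_nat (v t) ^ \<beta> t))) = 0"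
        unfolding gsum .
      moreover have "z ^ (\<Sum>t\<in>UNIV. ?x t * v t) = z ^ (\<Sum>t\<in>UNIV. x t * v t)" for v
      proof -
        have "z ^ (x t mod ?q) = z ^ x t" for t
        proof -
          have "z ^ x t = z ^ (?q * (x t div ?q) + x t mod ?q)" by simp
          also have "\<dots> = z ^ (x t mod ?q)" by (simp only: power_add power_mult z(1)) simp
          finally show ?thesis by simp
        qed
        then show ?thesis by (simp add: power_sum power_mult)
      qed
      ultimately show ?thesis by (simp add: mult.assoc)
    qed
    have row: "(\<Sum>j<N. h (en j' j) * c j) = 0" for j'
    proof -
      define K where "K v = g v * z ^ (\<Sum>t\<in>UNIV. a j' t * v t) * of_nat (\<Prod>t\<in>UNIV. v t choose \<alpha> j' t)" for v
      have hen: "h (en j' j) = (\<Sum>v\<in>V. of_int (f j v) * (z ^ (\<Sum>t\<in>UNIV. a j' t * v t) *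
          of_nat (\<Prod>t\<in>UNIV. v t choose \<alpha> j' t) *
          h (coeff (line_rem ?q (M j') (\<Sum>t\<in>UNIV. u j' t * v t)) (i j'))))" for j
        unfolding en_def h.hom_sum h.hom_mult
        by (simp add: h_def hom_distribs poly_monom)
      have "(\<Prod>r<?q. [:1 - z ^ r, 1:] ^ M j' r) dvd
          (\<Sum>v\<in>V. smult (K v) ([:1, 1:] ^ (\<Sum>t\<in>UNIV. u j' t * v t)))"
        unfolding M_def K_def by (rule roots_product_dvd_restriction[OF z0 z(2) gE])
      from line_rem_combination_eq_0[OF this, of "i j'"]
      have "(\<Sum>v\<in>V. g v * (z ^ (\<Sum>t\<in>UNIV. a j' t * v t) * of_nat (\<Prod>t\<in>UNIV. v t choose \<alpha> j' t) *
          h (coeff (line_rem ?q (M j') (\<Sum>t\<in>UNIV. u j' t * v t)) (i j')))) = 0"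
        by (simp add: K_def h_def mult.assoc)
      then show ?thesis unfolding gsum hen .
    qed
    let ?Ah = "map_mat h A"
    have Ah: "?Ah \<in> carrier_mat N N" using A by simp
    have "?Ah *\<^sub>v Matrix.vec N c = 0\<^sub>v N"
    proof (rule eq_vecI)
      fix r assume "r < dim_vec (0\<^sub>v N :: complex Matrix.vec)"
      then have r: "r < N" by simp
      have "vec_index (?Ah *\<^sub>v Matrix.vec N c) r = (\<Sum>j = 0..<N. h (en r j) * c j)"
        using r by (simp add: A_def scalar_prod_def)
      also have "\<dots> = 0" using row[of r] by (simp add: lessThan_atLeast0)
      finally show "vec_index (?Ah *\<^sub>v Matrix.vec N c) r = vec_index (0\<^sub>v N) r" using r by simp
    qed (simp add: A_def)
    moreover have "Matrix.vec N c \<noteq> 0\<^sub>v N"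
    proof
      assume eq: "Matrix.vec N c = 0\<^sub>v N"
      from c obtain j where j: "j < N" "c j \<noteq> 0" by blast
      from arg_cong[OF eq, of "\<lambda>y. vec_index y j"] j show False by simp
    qed
    ultimately have "Determinant.det ?Ah = 0"
      unfolding det_0_iff_vec_prod_zero[OF Ah] by (intro exI[of _ "Matrix.vec N c"]) auto
    then have "h (Determinant.det A) = 0" by (simp add: comm_ring_hom.hom_det[OF h.comm_ring_hom_axioms])
    then show "poly (of_int_poly (Determinant.det A)) z = 0" by (simp add: h_def)
  qed
  with det1 show False by simp
qed

subsection \<open>Automorphisms and the projective space\<close>

lemma of_nat_mod_ring_eq_0_iff: "of_nat x = (0 :: 'a::nontriv mod_ring) \<longleftrightarrow> CARD('a) dvd x"
  by (simp add: of_nat_eq_0_iff_char_dvd semiring_char_mod_ring)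

lemma bij_betw_of_nat_mod_ring: "bij_betw of_nat {..<CARD('a)} (UNIV :: 'a::nontriv mod_ring set)"
proof -
  have *: "x = y" if "x \<le> y" "y < CARD('a)" "(of_nat x :: 'a mod_ring) = of_nat y" for x y
  proof -
    have "of_nat (y - x) = (0 :: 'a mod_ring)" using that by (simp add: of_nat_diff)
    then have "CARD('a) dvd y - x" by (simp only: of_nat_mod_ring_eq_0_iff)
    from dvd_imp_le[OF this] that show ?thesis by (cases "x = y") auto
  qed
  have i: "inj_on (of_nat :: nat \<Rightarrow> 'a mod_ring) {..<CARD('a)}"
    by (rule inj_onI) (metis * lessThan_iff nat_le_linear)
  have "(of_nat :: nat \<Rightarrow> 'a mod_ring) ` {..<CARD('a)} = UNIV"
    by (rule card_subset_eq) (use card_image[OF i] in auto)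
  with i show ?thesis by (simp add: bij_betw_def)
qed

lemma of_nat_mod_CARD: "of_nat (x mod CARD('a)) = (of_nat x :: 'a::nontriv mod_ring)"
proof -
  have "(of_nat x :: 'a mod_ring) = of_nat (CARD('a) * (x div CARD('a)) + x mod CARD('a))" by simp
  also have "\<dots> = of_nat (x mod CARD('a))" by (simp only: of_nat_add of_nat_mult of_nat_card_eq_0) simp
  finally show ?thesis by simp
qed

lemma unit_mod_ring_of_nat:
  assumes "prime p" "CARD('a::nontriv) = p ^ k" "\<not> p dvd x"
  shows "(of_nat x :: 'a mod_ring) dvd 1"
proof -
  have "coprime x (p ^ k)"
    using assms by (meson coprime_commute coprime_power_left_iff prime_imp_coprime)
  then obtain a b where ab: "x * a = p ^ k * b + 1"
    using bezout_nat[of x "p ^ k"] assms(1,3) by (metis coprime_iff_gcd_eq_1 dvd_0_right)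
  have "(of_nat x * of_nat a :: 'a mod_ring) = of_nat (CARD('a) * b + 1)"
    by (simp only: ab assms(2) flip: of_nat_mult)
  then have "(of_nat x * of_nat a :: 'a mod_ring) = 1"
    by (simp only: of_nat_add of_nat_mult of_nat_card_eq_0) simp
  then show ?thesis by (metis dvd_triv_left)
qed

text \<open>The nonunits are the elements annihilated by \<open>p ^ (k - 1)\<close>, which turns
  failure of unimodularity into linear equations that shears preserve.\<close>

lemma unit_mod_ring_iff:
  assumes p: "prime p" and k: "k \<ge> 1" and q: "CARD('a::nontriv) = p ^ k"
  shows "(c :: 'a mod_ring) dvd 1 \<longleftrightarrow> of_nat (p ^ (k - 1)) * c \<noteq> 0"
proof
  assume "c dvd 1"
  then obtain d where d: "1 = c * d" by (auto elim: dvdE)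
  show "of_nat (p ^ (k - 1)) * c \<noteq> 0"
  proof
    assume "of_nat (p ^ (k - 1)) * c = 0"
    then have "of_nat (p ^ (k - 1)) * (c * d) = 0" by (simp flip: mult.assoc)
    then have "(of_nat (p ^ (k - 1)) :: 'a mod_ring) = 0" by (simp flip: d)
    then have "p ^ k dvd p ^ (k - 1)" unfolding of_nat_mod_ring_eq_0_iff q .
    then show False using p k by (simp add: dvd_power_iff_le prime_ge_2_nat)
  qed
next
  assume nz: "of_nat (p ^ (k - 1)) * c \<noteq> 0"
  obtain x where x: "c = of_nat x" using bij_betw_of_nat_mod_ring unfolding bij_betw_def by (metis UNIV_I imageE)
  have "\<not> p dvd x"
  proof
    assume "p dvd x"
    then have "p ^ (k - 1) * p dvd p ^ (k - 1) * x" by (rule mult_dvd_mono[OF dvd_refl])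
    moreover have "p ^ (k - 1) * p = CARD('a)" using k q by (simp flip: power_Suc2)
    ultimately have "of_nat (p ^ (k - 1) * x) = (0 :: 'a mod_ring)"
      by (simp only: of_nat_mod_ring_eq_0_iff)
    with nz show False unfolding x by simp
  qed
  then show "c dvd 1" unfolding x by (rule unit_mod_ring_of_nat[OF p q])
qed

definition unimodular_automorphisms :: "(('a::comm_ring_1 ^ 'n) \<Rightarrow> ('a ^ 'n)) set" where
  "unimodular_automorphisms = {A. bij A \<and> (\<forall>x y. A (x + y) = A x + A y) \<and> (\<forall>c x. A (c *s x) = c *s A x) \<and>
     (\<forall>x. A x \<in> unimodular_vectors \<longleftrightarrow> x \<in> unimodular_vectors)}"

lemma unimodular_automorphismsD:
  assumes "A \<in> unimodular_automorphisms"
  shows "bij A" "A (x + y) = A x + A y" "A (c *s x) = c *s A x"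
    "A x \<in> unimodular_vectors \<longleftrightarrow> x \<in> unimodular_vectors"
  using assms by (auto simp: unimodular_automorphisms_def)

lemma id_unimodular_automorphisms: "id \<in> unimodular_automorphisms"
  by (simp add: unimodular_automorphisms_def)

lemma comp_unimodular_automorphisms:
  assumes "A \<in> unimodular_automorphisms" "B \<in> unimodular_automorphisms"
  shows "A \<circ> B \<in> unimodular_automorphisms"
  using assms by (simp add: unimodular_automorphisms_def bij_comp)

lemma unimodular_automorphism_if_inverse:
  fixes A B :: "'a::comm_ring_1 ^ 'n \<Rightarrow> 'a ^ 'n"
  assumes "\<And>x. B (A x) = x" "\<And>x. A (B x) = x" "\<And>x y. A (x + y) = A x + A y" "\<And>c x. A (c *s x) = c *s A x"
    and "\<And>x. A x \<in> unimodular_vectors \<Longrightarrow> x \<in> unimodular_vectors"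
    and "\<And>x. B x \<in> unimodular_vectors \<Longrightarrow> x \<in> unimodular_vectors"
  shows "A \<in> unimodular_automorphisms"
proof -
  have bij: "bij A" by (rule bij_betw_byWitness[where f' = B]) (auto simp: assms(1,2))
  have iff: "A x \<in> unimodular_vectors \<longleftrightarrow> x \<in> unimodular_vectors" for x
    using assms(5)[of x] assms(6)[of "A x"] unfolding assms(1) by blast
  show ?thesis unfolding unimodular_automorphisms_def
    by (intro CollectI conjI allI bij assms(3,4) iff)
qed

text \<open>If both vectors have a unit in coordinate \<open>i\<close>, the shear
  \<open>z + (z $ i * d) *s (y - x)\<close>, with \<open>d\<close> inverse to \<open>x $ i\<close>,
  carries \<open>x\<close> to \<open>y\<close> and has an inverse of the same shape. A transposition
  of coordinates first aligns the unit positions.\<close>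

lemma unimodular_automorphisms_transitive:
  fixes u v :: "'a::nontriv mod_ring ^ 'n"
  assumes p: "prime p" and k: "k \<ge> 1" and q: "CARD('a) = p ^ k"
    and u: "u \<in> unimodular_vectors" and v: "v \<in> unimodular_vectors"
  shows "\<exists>A\<in>unimodular_automorphisms. A u = v"
proof -
  note unit = unit_mod_ring_iff[OF p k q]
  have shear: "\<exists>A\<in>unimodular_automorphisms. A x = y"
    if xi: "x $ i dvd 1" and yi: "y $ i dvd 1" for x y :: "'a mod_ring ^ 'n" and i
  proof -
    obtain d where d: "x $ i * d = 1" using xi by (metis dvdE)
    obtain e where e: "y $ i * e = 1" using yi by (metis dvdE)
    define S where "S d x y z = z + (z $ i * d) *s (y - x)" for d and x y z :: "'a mod_ring ^ 'n"
    have inv: "S e y x (S d x y z) = z" if "x $ i * d = 1" "y $ i * e = 1" for x y z d e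
    proof -
      have "(S d x y z) $ i * e = z $ i * e * (1 - x $ i * d) + z $ i * d * (y $ i * e)"
        by (simp add: S_def algebra_simps)
      then have "(S d x y z) $ i * e = z $ i * d" using that by simp
      then have "S e y x (S d x y z) = S d x y z + (z $ i * d) *s (x - y)" by (simp add: S_def)
      then show ?thesis by (simp add: S_def Finite_Cartesian_Product.vec_eq_iff algebra_simps)
    qed
    have lift: "z \<in> unimodular_vectors" if "S d x y z \<in> unimodular_vectors" for d x y z
    proof (rule ccontr)
      assume "z \<notin> unimodular_vectors"
      then have z: "of_nat (p ^ (k - 1)) * z $ j = 0" for j
        using unit by (auto simp: unimodular_vectors_def)
      have "of_nat (p ^ (k - 1)) * S d x y z $ j =
          of_nat (p ^ (k - 1)) * z $ j + (of_nat (p ^ (k - 1)) * z $ i) * (d * (y $ j - x $ j))" for j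
        by (simp add: S_def algebra_simps)
      then have "of_nat (p ^ (k - 1)) * S d x y z $ j = 0" for j unfolding z by simp
      then show False using that unit by (auto simp: unimodular_vectors_def)
    qed
    have "S d x y \<in> unimodular_automorphisms"
    proof (rule unimodular_automorphism_if_inverse[where B = "S e y x"])
      show "S d x y (z + z') = S d x y z + S d x y z'" for z z'
        by (simp add: S_def Finite_Cartesian_Product.vec_eq_iff algebra_simps)
      show "S d x y (c *s z) = c *s S d x y z" for c z
        by (simp add: S_def Finite_Cartesian_Product.vec_eq_iff algebra_simps)
    qed (use inv d e lift in auto)
    moreover have "S d x y x = y" unfolding S_def d by simp
    ultimately show ?thesis by blast
  qed
  obtain i j where i: "u $ i dvd 1" and j: "v $ j dvd 1"
    using u v by (auto simp: unimodular_vectors_def)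
  define P where "P z = (\<chi> s. z $ (if s = i then j else if s = j then i else s))" for z :: "'a mod_ring ^ 'n"
  have PP: "P (P z) = z" for z by (subst Finite_Cartesian_Product.vec_eq_iff) (simp add: P_def)
  have "P \<in> unimodular_automorphisms"
    by (rule unimodular_automorphism_if_inverse[where B = P])
       (auto simp: PP, auto simp: P_def Finite_Cartesian_Product.vec_eq_iff unimodular_vectors_def split: if_splits)
  moreover have "P u $ j dvd 1" using i by (simp add: P_def)
  then obtain A where "A \<in> unimodular_automorphisms" "A (P u) = v" using shear[of "P u" j v] j by blast
  ultimately show ?thesis
    by (intro bexI[of _ "A \<circ> P"] comp_unimodular_automorphisms) auto
qed

lemma proj_space_class:
  assumes "P \<in> proj_space" "x \<in> P"
  shows "P = unit_multiple_rel `` {x}" "x \<in> unimodular_vectors"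
proof -
  note eq = equiv_unit_multiple_rel[where 'a = 'a and 'n = 'b]
  obtain y where y: "P = unit_multiple_rel `` {y}" "y \<in> unimodular_vectors"
    using assms(1) unfolding proj_space_def by (rule quotientE)
  then have "(y, x) \<in> unit_multiple_rel" using assms(2) by auto
  then show "P = unit_multiple_rel `` {x}" using y(1) equiv_class_eq[OF eq] by blast
  show "x \<in> unimodular_vectors" using \<open>(y, x) \<in> unit_multiple_rel\<close> by (auto simp: unit_multiple_rel_def)
qed

lemma unimodular_automorphism_mem_class:
  assumes A: "A \<in> unimodular_automorphisms" and "P \<in> proj_space" "Q \<in> proj_space"
    and x: "x \<in> P" "A x \<in> Q" and y: "y \<in> P"
  shows "A y \<in> Q"
proof -
  have "(x, y) \<in> unit_multiple_rel" using proj_space_class(1)[OF assms(2) x(1)] y by auto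
  then have "(A x, A y) \<in> unit_multiple_rel"
    using unimodular_automorphismsD(3,4)[OF A] by (auto simp: unit_multiple_rel_def)
  then show ?thesis using proj_space_class(1)[OF assms(3) x(2)] by auto
qed

lemma proj_space_nonempty: "P \<in> proj_space \<Longrightarrow> P \<noteq> {}"
  unfolding proj_space_def using equiv_unit_multiple_rel by (metis in_quotient_imp_non_empty)

text \<open>Composition with an automorphism carrying \<open>Q\<close> into \<open>R\<close> injects
  the maps sending \<open>u\<close> into \<open>Q\<close> into those sending it into
  \<open>R\<close>. These sets therefore have equal size, and they partition the group.\<close>

lemma card_automorphisms_into_class:
  fixes u :: "'a::nontriv mod_ring ^ 'n"
  assumes p: "prime p" and k: "k \<ge> 1" and q: "CARD('a) = p ^ k"
    and u: "u \<in> unimodular_vectors" and P: "P \<in> proj_space"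
  shows "card (proj_space :: ('a mod_ring ^ 'n) set set) * card {A \<in> unimodular_automorphisms. A u \<in> P} =
           card (unimodular_automorphisms :: ('a mod_ring ^ 'n \<Rightarrow> _) set)"
proof -
  let ?G = "unimodular_automorphisms :: ('a mod_ring ^ 'n \<Rightarrow> 'a mod_ring ^ 'n) set"
  let ?H = "\<lambda>Q. {A \<in> ?G. A u \<in> Q}"
  have le: "card (?H Q) \<le> card (?H R)" if Q: "Q \<in> proj_space" and R: "R \<in> proj_space" for Q R
  proof -
    obtain x y where x: "x \<in> Q" and y: "y \<in> R" using proj_space_nonempty Q R by (metis ex_in_conv)
    obtain C where C: "C \<in> ?G" "C x = y"
      using unimodular_automorphisms_transitive[OF p k q proj_space_class(2)[OF Q x] proj_space_class(2)[OF R y]]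
      by blast
    show ?thesis
    proof (rule card_inj_on_le[where f = "\<lambda>A. C \<circ> A"])
      show "inj_on (\<lambda>A. C \<circ> A) (?H Q)"
      proof (rule inj_onI, rule ext)
        fix A B z assume "C \<circ> A = C \<circ> B"
        then have "C (A z) = C (B z)" by (metis comp_apply)
        then show "A z = B z"
          using unimodular_automorphismsD(1)[OF C(1)] by (metis bij_is_inj injD)
      qed
      show "(\<lambda>A. C \<circ> A) ` ?H Q \<subseteq> ?H R"
        using C y x unimodular_automorphism_mem_class[OF C(1) Q R x]
        by (auto intro: comp_unimodular_automorphisms)
    qed simp
  qed
  have "?G = (\<Union>Q\<in>proj_space. ?H Q)"
  proof -
    have "A u \<in> unit_multiple_rel `` {A u}" "unit_multiple_rel `` {A u} \<in> proj_space" if "A \<in> ?G" for A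
      using unimodular_automorphismsD(4)[OF that] u
        equiv_class_self[OF equiv_unit_multiple_rel] by (auto simp: proj_space_def intro: quotientI)
    then show ?thesis by blast
  qed
  then have "card ?G = card (\<Union>Q\<in>proj_space. ?H Q)" by simp
  also have "\<dots> = (\<Sum>Q\<in>proj_space. card (?H Q))"
  proof (rule card_UN_disjoint)
    show "\<forall>Q\<in>proj_space. \<forall>R\<in>proj_space. Q \<noteq> R \<longrightarrow> ?H Q \<inter> ?H R = {}"
      using proj_space_class(1) by blast
  qed auto
  also have "\<dots> = (\<Sum>Q\<in>(proj_space :: ('a mod_ring ^ 'n) set set). card (?H P))"
    using le P by (intro sum.cong refl antisym) auto
  finally show ?thesis by simp
qed

section \<open>Maximal values along lines and admissible jets\<close>

text \<open>Plays two roles: the number of conditions for vanishing to order \<open>M\<close> at a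
  point, and the number of monomials of degree below \<open>M\<close>.\<close>

definition simplex_count :: "'n::finite itself \<Rightarrow> nat \<Rightarrow> nat" where
  "simplex_count _ M = card {\<beta> :: 'n \<Rightarrow> nat. sum \<beta> UNIV < M}"

text \<open>The maximal function on vectors instead of classes, since automorphisms need not respect
  the chosen representatives.\<close>

definition direction_max :: "('a::{finite,comm_ring_1} ^ 'n \<Rightarrow> nat) \<Rightarrow> 'a ^ 'n \<Rightarrow> nat" where
  "direction_max f u = (SUP a. \<Sum>t\<in>UNIV. f (a + t *s u))"

lemma direction_max_attained: "\<exists>a. direction_max f u = (\<Sum>t\<in>UNIV. f (a + t *s u))"
proof -
  let ?S = "range (\<lambda>a. \<Sum>t\<in>UNIV. f (a + t *s u))"
  have "Sup ?S = Max ?S" by (rule cSup_eq_Max) auto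
  moreover have "Max ?S \<in> ?S" by (rule Max_in) auto
  then obtain a where "Max ?S = (\<Sum>t\<in>UNIV. f (a + t *s u))" by (rule imageE)
  ultimately show ?thesis unfolding direction_max_def by (intro exI[of _ a]) simp
qed

lemma direction_max_unit_multiple:
  fixes u :: "'a::{finite,comm_ring_1} ^ 'n"
  assumes "c dvd 1"
  shows "direction_max f (c *s u) = direction_max f u"
proof -
  obtain d where d: "c * d = 1" using assms by (metis dvdE)
  have "bij (\<lambda>t. t * c)"
    by (rule bij_betw_byWitness[where f' = "\<lambda>t. t * d"]) (use d in \<open>auto simp: mult.assoc mult.commute[of d c]\<close>)
  then have "(\<Sum>t\<in>UNIV. f (a + (t * c) *s u)) = (\<Sum>t\<in>UNIV. f (a + t *s u))" for a
    by (rule sum.reindex_bij_betw)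
  then show ?thesis by (simp add: direction_max_def vector_smult_assoc)
qed

lemma maximal_function_eq_direction_max:
  assumes "proj_representatives rep" "P \<in> proj_space" "x \<in> P"
  shows "maximal_function rep f P = direction_max f x"
proof -
  have "rep P \<in> P" using assms(1,2) by (simp add: proj_representatives_def)
  then have "(x, rep P) \<in> unit_multiple_rel" using proj_space_class(1)[OF assms(2,3)] by auto
  then obtain c where "c dvd 1" "rep P = c *s x" by (auto simp: unit_multiple_rel_def)
  then show ?thesis
    unfolding maximal_function_def direction_max_def[symmetric] by (simp add: direction_max_unit_multiple)
qed

definition vec_of_nat :: "('n \<Rightarrow> nat) \<Rightarrow> 'a::semiring_1 ^ 'n" where
  "vec_of_nat x = (\<chi> t. of_nat (x t))"

lemma bij_betw_vec_of_nat:
  "bij_betw vec_of_nat (PiE UNIV (\<lambda>_. {..<CARD('a)})) (UNIV :: ('a::nontriv mod_ring ^ 'n) set)"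
proof -
  note b = bij_betw_of_nat_mod_ring[where 'a = 'a]
  define g where "g = inv_into {..<CARD('a)} (of_nat :: nat \<Rightarrow> 'a mod_ring)"
  have g: "g c < CARD('a)" "of_nat (g c) = c" for c
    using b inv_into_into[of c of_nat "{..<CARD('a)}"] f_inv_into_f[of c of_nat "{..<CARD('a)}"]
    by (auto simp: g_def bij_betw_def)
  have g': "g (of_nat x) = x" if "x < CARD('a)" for x
    using b that unfolding g_def by (auto simp: bij_betw_def intro: inv_into_f_f)
  show ?thesis
    by (rule bij_betw_byWitness[where f' = "\<lambda>y t. g (vec_nth y t)"])
       (auto simp: vec_of_nat_def g g' Finite_Cartesian_Product.vec_eq_iff PiE_iff fun_eq_iff)
qed

lemma exists_vec_of_nat: "\<exists>x. vec_of_nat x = (y :: 'a::nontriv mod_ring ^ 'n)"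
  using bij_betw_vec_of_nat unfolding bij_betw_def by (metis UNIV_I imageE)

text \<open>Truncated subtraction of \<open>b\<close> costs nothing where \<open>g\<close> vanishes.
  Here \<open>b\<close> will be the number of transversal derivatives, and the support bound
  \<open>c\<close> becomes their weight \<open>p ^ l\<close>.\<close>

lemma sum_mult_minus_le:
  fixes g :: "'t \<Rightarrow> nat"
  assumes "finite T" "card {t \<in> T. g t \<noteq> 0} \<le> c"
  shows "m * (\<Sum>t\<in>T. g t) \<le> (\<Sum>t\<in>T. m * g t - b) + c * b"
proof -
  have "m * (\<Sum>t\<in>T. g t) \<le> (\<Sum>t\<in>T. (m * g t - b) + (if g t \<noteq> 0 then b else 0))"
    unfolding sum_distrib_left by (intro sum_mono) auto
  also have "\<dots> = (\<Sum>t\<in>T. m * g t - b) + card {t \<in> T. g t \<noteq> 0} * b"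
    using assms(1) by (subst sum.distrib) (simp flip: sum.inter_filter)
  also have "\<dots> \<le> (\<Sum>t\<in>T. m * g t - b) + c * b" using assms(2) by simp
  finally show ?thesis .
qed

text \<open>\<open>triangular_jets_length_le\<close> applied to \<open>f\<close> composed with
  \<open>A\<close>. A jet is admissible when its level lies below \<open>m\<close> times the largest
  sum of \<open>f\<close> over a line in direction \<open>A u\<close>; discarding the other jets
  keeps the family triangular.\<close>

lemma card_admissible_jets_le:
  fixes f :: "'a::nontriv mod_ring ^ 'n \<Rightarrow> nat" and u \<alpha> :: "nat \<Rightarrow> 'n \<Rightarrow> nat"
  assumes p: "prime p" and k: "k \<ge> 1" and q: "CARD('a) = p ^ k"
    and A: "A \<in> unimodular_automorphisms"
    and w: "\<And>y. y \<in> unimodular_vectors \<Longrightarrow> direction_max f y \<le> w" and wl: "w \<le> p ^ l \<or> p ^ k \<le> p ^ l"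
    and uni: "\<And>j t. j < L \<Longrightarrow> \<not> p dvd u j t"
    and diag: "\<And>j. j < L \<Longrightarrow> \<not> int p dvd (\<Sum>v\<in>V. g j v * int (jet_coeff (u j) (\<alpha> j) (i j) v))"
    and tri: "\<And>j j'. j < L \<Longrightarrow> j' < j \<Longrightarrow>
                (\<Sum>v\<in>V. g j v * int (jet_coeff (u j') (\<alpha> j') (i j') v)) = 0"
  shows "card {j. j < L \<and> i j + p ^ l * sum (\<alpha> j) UNIV < m * direction_max f (A (vec_of_nat (u j)))}
           \<le> (\<Sum>x\<in>UNIV. simplex_count TYPE('n) (m * f x))"
proof -
  define J where "J = {j. j < L \<and> i j + p ^ l * sum (\<alpha> j) UNIV < m * direction_max f (A (vec_of_nat (u j)))}"
  define js where "js = sorted_list_of_set J"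
  have fJ: "finite J" unfolding J_def by simp
  then have js: "set js = J" "length js = card J" "sorted_wrt (<) js" by (simp_all add: js_def)
  have jsJ: "js ! r \<in> J" if "r < card J" for r using that js nth_mem by metis
  note AD = unimodular_automorphismsD[OF A]
  define F where "F x = m * f (A (vec_of_nat x))" for x
  have "\<exists>a. i j < (\<Sum>r<p ^ k. F (\<lambda>t. a t + r * u j t) - sum (\<alpha> j) UNIV)" if "j \<in> J" for j
  proof -
    let ?u = "vec_of_nat (u j) :: 'a mod_ring ^ 'n"
    let ?b = "sum (\<alpha> j) UNIV"
    have jL: "j < L" and lev: "i j + p ^ l * ?b < m * direction_max f (A ?u)" using that by (auto simp: J_def)
    obtain a0 where a0: "direction_max f (A ?u) = (\<Sum>t\<in>UNIV. f (a0 + t *s A ?u))"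
      using direction_max_attained by blast
    obtain y where y: "A y = a0" using AD(1) by (metis bij_pointE)
    obtain a where a: "vec_of_nat a = y" using exists_vec_of_nat by blast
    have "vec_of_nat (\<lambda>t. a t + r * u j t) = y + of_nat r *s ?u" for r
      by (simp add: vec_of_nat_def Finite_Cartesian_Product.vec_eq_iff flip: a)
    then have Fl: "F (\<lambda>t. a t + r * u j t) = m * f (a0 + of_nat r *s A ?u)" for r
      unfolding F_def by (simp add: AD(2,3) y)
    have unim: "?u \<in> unimodular_vectors"
      using unit_mod_ring_of_nat[OF p q uni[OF jL]] by (auto simp: unimodular_vectors_def vec_of_nat_def)
    let ?h = "\<lambda>t. f (a0 + t *s A ?u)"
    \<comment> \<open>Nonzero values are at least \<open>1\<close>, so there are at most
      \<open>w\<close> of them; in the other case the \<open>p ^ k\<close> parameters of the line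
      give the bound.\<close>
    have "card {t \<in> UNIV. ?h t \<noteq> 0} \<le> p ^ l"
    proof (cases "w \<le> p ^ l")
      case True
      have "card {t \<in> UNIV. ?h t \<noteq> 0} = (\<Sum>t\<in>{t \<in> UNIV. ?h t \<noteq> 0}. 1)" by simp
      also have "\<dots> \<le> (\<Sum>t\<in>{t \<in> UNIV. ?h t \<noteq> 0}. ?h t)" by (rule sum_mono) auto
      also have "\<dots> \<le> (\<Sum>t\<in>UNIV. ?h t)" by (rule sum_mono2) auto
      also have "\<dots> \<le> w" unfolding a0[symmetric] by (rule w) (simp add: AD(4) unim)
      finally show ?thesis using True by simp
    next
      case False
      have "card {t \<in> UNIV. ?h t \<noteq> 0} \<le> CARD('a mod_ring)" by (rule card_mono) auto
      then show ?thesis using False wl q by simp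
    qed
    from sum_mult_minus_le[OF _ this, where m = m and b = ?b]
    have "m * direction_max f (A ?u) \<le> (\<Sum>t\<in>UNIV. m * ?h t - ?b) + p ^ l * ?b" unfolding a0 by simp
    moreover have "(\<Sum>t\<in>UNIV. m * ?h t - ?b) = (\<Sum>r<p ^ k. F (\<lambda>t. a t + r * u j t) - ?b)"
      unfolding Fl q[symmetric]
      by (rule sum.reindex_bij_betw[OF bij_betw_of_nat_mod_ring, symmetric])
    ultimately show ?thesis using lev by (intro exI[of _ a]) linarith
  qed
  then obtain a where a: "\<And>j. j \<in> J \<Longrightarrow> i j < (\<Sum>r<p ^ k. F (\<lambda>t. a j t + r * u j t) - sum (\<alpha> j) UNIV)"
    by metis
  have "card J \<le> (\<Sum>x\<in>PiE UNIV (\<lambda>_. {..<p ^ k}). card {\<beta> :: 'n \<Rightarrow> nat. sum \<beta> UNIV < F x})"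
  proof (rule triangular_jets_length_le[OF p k, where V = V and f = "\<lambda>r. g (js ! r)" and u = "\<lambda>r. u (js ! r)"
        and \<alpha> = "\<lambda>r. \<alpha> (js ! r)" and i = "\<lambda>r. i (js ! r)" and a = "\<lambda>r. a (js ! r)"])
    fix r assume r: "r < card J"
    then show "\<not> int p dvd (\<Sum>v\<in>V. g (js ! r) v * int (jet_coeff (u (js ! r)) (\<alpha> (js ! r)) (i (js ! r)) v))"
      using jsJ[OF r] diag by (simp add: J_def)
    show "i (js ! r) < (\<Sum>s<p ^ k. F (\<lambda>t. a (js ! r) t + s * u (js ! r) t) - sum (\<alpha> (js ! r)) UNIV)"
      by (rule a[OF jsJ[OF r]])
    fix r' assume "r' < r"
    then have "js ! r' < js ! r" using sorted_wrt_nth_less[OF js(3)] r js(2) by simp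
    then show "(\<Sum>v\<in>V. g (js ! r) v * int (jet_coeff (u (js ! r')) (\<alpha> (js ! r')) (i (js ! r')) v)) = 0"
      using jsJ[OF r] tri by (simp add: J_def)
  next
    show "F (\<lambda>t. x t mod p ^ k) = F x" for x
      unfolding F_def vec_of_nat_def q[symmetric] of_nat_mod_CARD ..
  qed
  also have "\<dots> = (\<Sum>x\<in>PiE UNIV (\<lambda>_. {..<CARD('a)}). simplex_count TYPE('n) (m * f (A (vec_of_nat x))))"
    by (simp add: q F_def simplex_count_def)
  also have "\<dots> = (\<Sum>x\<in>UNIV. simplex_count TYPE('n) (m * f (A x)))"
    by (rule sum.reindex_bij_betw[OF bij_betw_vec_of_nat])
  also have "\<dots> = (\<Sum>x\<in>UNIV. simplex_count TYPE('n) (m * f x))"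
    by (rule sum.reindex_bij_betw[OF AD(1)])
  finally show ?thesis unfolding J_def .
qed

subsection \<open>Averaging and asymptotics\<close>

text \<open>Averaging over the automorphisms spreads each direction \<open>u j\<close> evenly over the
  projective space.\<close>

lemma sum_simplex_count_maximal_function_le:
  fixes f :: "'a::nontriv mod_ring ^ 'n \<Rightarrow> nat"
  assumes p: "prime p" and k: "k \<ge> 1" and q: "CARD('a) = p ^ k"
    and rep: "proj_representatives rep"
    and w: "\<And>P. P \<in> proj_space \<Longrightarrow> maximal_function rep f P \<le> w" and wl: "w \<le> p ^ l \<or> p ^ k \<le> p ^ l"
  shows "(\<Sum>P\<in>proj_space. simplex_count TYPE('n) (\<mu> * maximal_function rep f P)) \<le>
           card (proj_space :: ('a mod_ring ^ 'n) set set) *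
             (\<Sum>x\<in>UNIV. simplex_count TYPE('n) ((1 + l) * \<mu> * f x))"
proof -
  let ?PS = "proj_space :: ('a mod_ring ^ 'n) set set"
  let ?G = "unimodular_automorphisms :: ('a mod_ring ^ 'n \<Rightarrow> 'a mod_ring ^ 'n) set"
  \<comment> \<open>A monomial of degree below \<open>\<mu> * f\<^sup>*\<close> carries a jet of
    level below \<open>m * f\<^sup>*\<close>. The bound \<open>\<mu> * w\<close> in \<open>V\<close>
    serves all projective points at once.\<close>
  define m where "m = (1 + l) * \<mu>"
  define V where "V = {v :: 'n \<Rightarrow> nat. sum v UNIV < \<mu> * w}"
  have V: "finite V" unfolding V_def by (rule finite_simplex)
  obtain vs where vs: "set vs = V" "distinct vs" using finite_distinct_list[OF V] by blast
  define xs where "xs = sort_key (\<lambda>v. sum v UNIV) vs"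
  have xs: "distinct xs" "sorted (map (\<lambda>v. sum v UNIV) xs)" "set xs \<subseteq> V" "set xs = V"
    using vs by (simp_all add: xs_def)
  let ?L = "length xs"
  obtain u \<alpha> i and g :: "nat \<Rightarrow> ('n \<Rightarrow> nat) \<Rightarrow> int" where fam: "\<forall>j<?L. (\<forall>t. \<not> p dvd u j t) \<and>
           i j + p ^ l * sum (\<alpha> j) UNIV \<le> (1 + l) * sum (xs ! j) UNIV \<and>
           \<not> int p dvd (\<Sum>v\<in>V. g j v * int (jet_coeff (u j) (\<alpha> j) (i j) v)) \<and>
           (\<forall>j'<j. (\<Sum>v\<in>V. g j v * int (jet_coeff (u j') (\<alpha> j') (i j') v)) = 0)"
    using triangular_jets[OF p V xs(1-3), of l] by blast
  define lev where "lev j = i j + p ^ l * sum (\<alpha> j) UNIV" for j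
  define U where "U j = (vec_of_nat (u j) :: 'a mod_ring ^ 'n)" for j
  have lev: "lev j \<le> (1 + l) * sum (xs ! j) UNIV" if "j < ?L" for j
    using fam that by (simp add: lev_def)
  have U: "U j \<in> unimodular_vectors" if "j < ?L" for j
    using fam that unit_mod_ring_of_nat[OF p q] by (auto simp: U_def unimodular_vectors_def vec_of_nat_def)
  have cls: "unit_multiple_rel `` {y} \<in> proj_space" "y \<in> unit_multiple_rel `` {y}"
    if "y \<in> unimodular_vectors" for y :: "'a mod_ring ^ 'n"
    using that equiv_class_self[OF equiv_unit_multiple_rel] by (auto simp: proj_space_def intro: quotientI)
  have w': "direction_max f y \<le> w" if "y \<in> unimodular_vectors" for y
    using w[OF cls(1)[OF that]] maximal_function_eq_direction_max[OF rep cls[OF that]] by simp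
  define R where "R = (\<Sum>x\<in>UNIV. simplex_count TYPE('n) (m * f x))"
  have J: "card {j. j < ?L \<and> lev j < m * direction_max f (A (U j))} \<le> R" if "A \<in> ?G" for A
    unfolding lev_def U_def R_def
    by (rule card_admissible_jets_le[OF p k q that w' wl, where g = g and V = V]) (use fam in auto)
  define K where "K = card ?G div card ?PS"
  have finPS: "finite ?PS" by simp
  have K: "card {A \<in> ?G. A y \<in> P} = K" "card ?PS * K = card ?G"
    if "y \<in> unimodular_vectors" "P \<in> proj_space" for y P
  proof -
    have eq: "card ?PS * card {A \<in> ?G. A y \<in> P} = card ?G"
      by (rule card_automorphisms_into_class[OF p k q that])
    have "card ?PS > 0" using that(2) finPS by (auto simp: card_gt_0_iff)
    then show "card {A \<in> ?G. A y \<in> P} = K" unfolding K_def eq[symmetric] by simp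
    with eq show "card ?PS * K = card ?G" by simp
  qed
  have G0: "card ?G > 0" using id_unimodular_automorphisms by (auto simp: card_gt_0_iff)
  have each: "(\<Sum>A\<in>?G. of_bool (lev j < m * direction_max f (A (U j)))) =
      K * (\<Sum>P\<in>?PS. of_bool (lev j < m * maximal_function rep f P))" if j: "j < ?L" for j
  proof -
    let ?H = "\<lambda>P. {A \<in> ?G. A (U j) \<in> P}"
    have un: "(\<Union>P\<in>?PS. ?H P) = ?G"
    proof -
      have "A (U j) \<in> unimodular_vectors" if "A \<in> ?G" for A
        using unimodular_automorphismsD(4)[OF that] U[OF j] by simp
      with cls show ?thesis by blast
    qed
    have "(\<Sum>A\<in>?G. of_bool (lev j < m * direction_max f (A (U j))) :: nat) =
        (\<Sum>P\<in>?PS. \<Sum>A\<in>?H P. of_bool (lev j < m * direction_max f (A (U j))))"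
    proof (subst un[symmetric], rule sum.UNION_disjoint)
      show "\<forall>P\<in>?PS. \<forall>Q\<in>?PS. P \<noteq> Q \<longrightarrow> ?H P \<inter> ?H Q = {}"
        using proj_space_class(1) by blast
    qed auto
    also have "\<dots> = (\<Sum>P\<in>?PS. \<Sum>A\<in>?H P. of_bool (lev j < m * maximal_function rep f P))"
      using maximal_function_eq_direction_max[OF rep, of _ _ f] by (intro sum.cong refl) auto
    also have "\<dots> = (\<Sum>P\<in>?PS. K * of_bool (lev j < m * maximal_function rep f P))"
      by (intro sum.cong refl) (simp add: K(1)[OF U[OF j]])
    finally show ?thesis by (simp add: sum_distrib_left)
  qed
  have count: "simplex_count TYPE('n) (\<mu> * maximal_function rep f P) \<le>
      (\<Sum>j<?L. of_bool (lev j < m * maximal_function rep f P))" if P: "P \<in> ?PS" for P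
  proof -
    let ?M = "maximal_function rep f P"
    have "{v :: 'n \<Rightarrow> nat. sum v UNIV < \<mu> * ?M} \<subseteq> (\<lambda>j. xs ! j) ` {j. j < ?L \<and> lev j < m * ?M}"
    proof
      fix v :: "'n \<Rightarrow> nat" assume "v \<in> {v. sum v UNIV < \<mu> * ?M}"
      then have v: "sum v UNIV < \<mu> * ?M" by simp
      also have "\<dots> \<le> \<mu> * w" using w[OF P] by simp
      finally have "v \<in> set xs" by (simp add: xs(4) V_def)
      then obtain j where j: "j < ?L" "xs ! j = v" by (auto simp: in_set_conv_nth)
      have "lev j \<le> (1 + l) * sum v UNIV" using lev[OF j(1)] j(2) by simp
      also have "\<dots> < (1 + l) * (\<mu> * ?M)" using v by (intro mult_strict_left_mono) auto
      finally have "lev j < m * ?M" by (simp only: m_def mult.assoc)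
      with j show "v \<in> (\<lambda>j. xs ! j) ` {j. j < ?L \<and> lev j < m * ?M}" by auto
    qed
    then have "simplex_count TYPE('n) (\<mu> * ?M) \<le> card ((\<lambda>j. xs ! j) ` {j. j < ?L \<and> lev j < m * ?M})"
      unfolding simplex_count_def by (intro card_mono) auto
    also have "\<dots> \<le> card {j. j < ?L \<and> lev j < m * ?M}" by (rule card_image_le) auto
    also have "\<dots> = (\<Sum>j<?L. of_bool (lev j < m * ?M))"
      by (simp add: of_bool_def sum.If_cases Int_def)
    finally show ?thesis .
  qed
  have "K * (\<Sum>P\<in>?PS. simplex_count TYPE('n) (\<mu> * maximal_function rep f P)) \<le>
      K * (\<Sum>P\<in>?PS. \<Sum>j<?L. of_bool (lev j < m * maximal_function rep f P))"
    by (intro mult_le_mono2 sum_mono count)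
  also have "\<dots> = (\<Sum>j<?L. K * (\<Sum>P\<in>?PS. of_bool (lev j < m * maximal_function rep f P)))"
    by (subst sum.swap) (rule sum_distrib_left)
  also have "\<dots> = (\<Sum>j<?L. \<Sum>A\<in>?G. of_bool (lev j < m * direction_max f (A (U j))))"
    by (intro sum.cong refl each[symmetric]) simp
  also have "\<dots> = (\<Sum>A\<in>?G. card {j. j < ?L \<and> lev j < m * direction_max f (A (U j))})"
    by (subst sum.swap) (simp add: of_bool_def sum.If_cases Int_def)
  also have "\<dots> \<le> (\<Sum>A\<in>?G. R)" by (intro sum_mono J)
  finally have main: "K * (\<Sum>P\<in>?PS. simplex_count TYPE('n) (\<mu> * maximal_function rep f P)) \<le> card ?G * R"
    by simp
  show ?thesis
  proof (cases "?PS = {}")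
    case False
    then obtain P where P: "P \<in> ?PS" by blast
    then obtain y where "y \<in> P" using proj_space_nonempty by blast
    then have "y \<in> unimodular_vectors" by (rule proj_space_class(2)[OF P])
    then have KG: "card ?PS * K = card ?G" using K(2) P by blast
    then have "K > 0" using G0 by (cases K) auto
    moreover have "K * (\<Sum>P\<in>?PS. simplex_count TYPE('n) (\<mu> * maximal_function rep f P)) \<le> K * (card ?PS * R)"
      using main unfolding KG[symmetric] by (simp add: mult_ac)
    ultimately show ?thesis by (simp add: R_def m_def)
  qed simp
qed

section \<open>Lattice points of a simplex and the limit\<close>

text \<open>Giving the new coordinate the value \<open>M - b\<close> leaves a sum of at most
  \<open>b\<close> for the others; the hockey-stick identity adds up the counts.\<close>

lemma card_functions_sum_le:
  assumes "finite S"
  shows "finite {\<beta> :: 's \<Rightarrow> nat. (\<forall>t. t \<notin> S \<longrightarrow> \<beta> t = 0) \<and> sum \<beta> S \<le> M} \<and>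
    card {\<beta> :: 's \<Rightarrow> nat. (\<forall>t. t \<notin> S \<longrightarrow> \<beta> t = 0) \<and> sum \<beta> S \<le> M} = (M + card S) choose card S"
  using assms
proof (induction S arbitrary: M rule: finite_induct)
  case empty
  have "{\<beta> :: 's \<Rightarrow> nat. (\<forall>t. t \<notin> {} \<longrightarrow> \<beta> t = 0) \<and> sum \<beta> {} \<le> M} = {\<lambda>_. 0}" by auto
  then show ?case by simp
next
  case (insert s S)
  let ?T = "\<lambda>S M. {\<beta> :: 's \<Rightarrow> nat. (\<forall>t. t \<notin> S \<longrightarrow> \<beta> t = 0) \<and> sum \<beta> S \<le> M}"
  let ?I = "\<lambda>b. (\<lambda>\<beta>. \<beta>(s := M - b)) ` ?T S b"
  have eq: "?T (insert s S) M = (\<Union>b\<in>{..M}. ?I b)"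
  proof
    show "?T (insert s S) M \<subseteq> (\<Union>b\<in>{..M}. ?I b)"
    proof
      fix \<beta> assume "\<beta> \<in> ?T (insert s S) M"
      then have b: "\<And>t. t \<notin> S \<Longrightarrow> t \<noteq> s \<Longrightarrow> \<beta> t = 0" "\<beta> s + sum \<beta> S \<le> M" using insert.hyps by auto
      have "sum (\<beta>(s := 0)) S = sum \<beta> S" using insert.hyps by (intro sum.cong) auto
      then have "\<beta>(s := 0) \<in> ?T S (M - \<beta> s)" using b insert.hyps by auto
      moreover have "\<beta> = (\<beta>(s := 0))(s := M - (M - \<beta> s))" using b(2) by auto
      ultimately show "\<beta> \<in> (\<Union>b\<in>{..M}. ?I b)" by (intro UN_I[of "M - \<beta> s"]) (simp, rule image_eqI)
    qed
  next
    show "(\<Union>b\<in>{..M}. ?I b) \<subseteq> ?T (insert s S) M"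
    proof
      fix \<gamma> assume "\<gamma> \<in> (\<Union>b\<in>{..M}. ?I b)"
      then obtain b \<beta> where b: "b \<le> M" "\<beta> \<in> ?T S b" "\<gamma> = \<beta>(s := M - b)" by auto
      have "sum \<gamma> S = sum \<beta> S" using insert.hyps b(3) by (intro sum.cong) auto
      then show "\<gamma> \<in> ?T (insert s S) M" using b insert.hyps by auto
    qed
  qed
  have inj: "inj_on (\<lambda>\<beta>. \<beta>(s := M - b)) (?T S b)" for b
  proof (rule inj_onI, rule ext)
    fix \<beta> \<gamma> t assume a: "\<beta> \<in> ?T S b" "\<gamma> \<in> ?T S b" "\<beta>(s := M - b) = \<gamma>(s := M - b)"
    show "\<beta> t = \<gamma> t" using a(1,2) fun_cong[OF a(3), of t] insert.hyps by (cases "t = s") auto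
  qed
  have fin: "finite (?I b)" and card: "card (?I b) = (b + card S) choose card S" for b
    using insert.IH[of b] card_image[OF inj, of b] by auto
  have disj: "?I b \<inter> ?I b' = {}" if "b \<le> M" "b' \<le> M" "b \<noteq> b'" for b b'
  proof -
    have val: "\<gamma> s = M - c" if "\<gamma> \<in> ?I c" for \<gamma> c using that by auto
    have "M - b \<noteq> M - b'" using that by linarith
    then have False if "\<gamma> \<in> ?I b" "\<gamma> \<in> ?I b'" for \<gamma> using val[OF that(1)] val[OF that(2)] by simp
    then show ?thesis by blast
  qed
  have "card (?T (insert s S) M) = (\<Sum>b\<le>M. card (?I b))"
    unfolding eq
  proof (rule card_UN_disjoint)
    show "\<forall>b\<in>{..M}. finite (?I b)" by (intro ballI fin)
    show "\<forall>b\<in>{..M}. \<forall>b'\<in>{..M}. b \<noteq> b' \<longrightarrow> ?I b \<inter> ?I b' = {}"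
      by (intro ballI impI disj) simp_all
  qed simp
  also have "\<dots> = (\<Sum>b\<le>M. (card S + b) choose b)"
    unfolding card by (intro sum.cong refl) (simp add: add.commute binomial_symmetric[of "card S"])
  also have "\<dots> = Suc (card S + M) choose M" by (rule sum_choose_lower)
  also have "\<dots> = (M + card (insert s S)) choose card (insert s S)"
    using insert.hyps binomial_symmetric[of M "Suc (card S + M)"] by (simp add: add.commute Suc_diff_le)
  finally show ?case using fin unfolding eq by simp
qed

lemma simplex_count_Suc: "simplex_count TYPE('n::finite) (Suc M) = (M + CARD('n)) choose CARD('n)"
  using card_functions_sum_le[of "UNIV :: 'n set" M] by (simp add: simplex_count_def less_Suc_eq_le)

lemma simplex_count_asymptotics:
  "(\<lambda>\<mu>. real (simplex_count TYPE('n::finite) (\<mu> * c)) / real \<mu> ^ CARD('n)) \<longlonglongrightarrow> real c ^ CARD('n) / fact CARD('n)"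
proof (cases "c = 0")
  case True
  then show ?thesis by (simp add: simplex_count_def power_0_left)
next
  case False
  let ?n = "CARD('n)"
  have "((\<lambda>\<mu>. (\<Prod>i = 0..<?n. (real c + (real ?n - 1 - real i) / real \<mu>)) / fact ?n) \<longlongrightarrow>
      (\<Prod>i = 0..<?n. (real c + 0)) / fact ?n) sequentially"
    by (intro tendsto_intros lim_const_over_n) simp
  moreover have "\<forall>\<^sub>F \<mu> in sequentially. (\<Prod>i = 0..<?n. (real c + (real ?n - 1 - real i) / real \<mu>)) / fact ?n =
      real (simplex_count TYPE('n) (\<mu> * c)) / real \<mu> ^ ?n"
  proof (rule eventually_sequentiallyI[of 1])
    fix \<mu> :: nat assume \<mu>: "1 \<le> \<mu>"
    define M where "M = \<mu> * c - 1"
    have M: "\<mu> * c = Suc M" using \<mu> False by (simp add: M_def)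
    then have M': "real M = real \<mu> * real c - 1" by (metis add_diff_cancel_right' of_nat_Suc of_nat_mult add.commute)
    have "real (simplex_count TYPE('n) (\<mu> * c)) = (real (M + ?n)) gchoose ?n"
      unfolding M simplex_count_Suc by (simp add: binomial_gbinomial)
    also have "\<dots> = (\<Prod>i = 0..<?n. real (M + ?n) - real i) / fact ?n"
      by (simp add: gbinomial_prod_rev)
    finally have "real (simplex_count TYPE('n) (\<mu> * c)) / real \<mu> ^ ?n =
        (\<Prod>i = 0..<?n. (real (M + ?n) - real i) / real \<mu>) / fact ?n"
      by (simp add: prod_dividef)
    also have "(\<Prod>i = 0..<?n. (real (M + ?n) - real i) / real \<mu>) =
        (\<Prod>i = 0..<?n. (real c + (real ?n - 1 - real i) / real \<mu>))"
      using \<mu> by (intro prod.cong refl) (simp add: M' field_simps)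
    finally show "(\<Prod>i = 0..<?n. (real c + (real ?n - 1 - real i) / real \<mu>)) / fact ?n =
      real (simplex_count TYPE('n) (\<mu> * c)) / real \<mu> ^ ?n" by simp
  qed
  ultimately show ?thesis by (simp add: Lim_transform_eventually)
qed

text \<open>Divided by the power of \<open>\<mu>\<close>, the simplex counts on both sides tend to
  powers over the same factorial, which cancels; \<open>(1 + l) * f x\<close> leaves the factor
  \<open>(1 + l) ^ CARD('n)\<close>.\<close>

lemma sum_maximal_function_power_le:
  fixes f :: "'a::nontriv mod_ring ^ 'n \<Rightarrow> nat"
  assumes p: "prime p" and k: "k \<ge> 1" and q: "CARD('a) = p ^ k"
    and rep: "proj_representatives rep"
    and w: "\<And>P. P \<in> proj_space \<Longrightarrow> maximal_function rep f P \<le> w" and wl: "w \<le> p ^ l \<or> p ^ k \<le> p ^ l"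
  shows "(\<Sum>P\<in>proj_space. real (maximal_function rep f P) ^ CARD('n)) \<le>
           real (card (proj_space :: ('a mod_ring ^ 'n) set set)) * (1 + real l) ^ CARD('n) *
             (\<Sum>x\<in>UNIV. real (f x) ^ CARD('n))"
proof -
  let ?n = "CARD('n)"
  let ?PS = "proj_space :: ('a mod_ring ^ 'n) set set"
  let ?S = "\<lambda>c \<mu>. real (simplex_count TYPE('n) (\<mu> * c)) / real \<mu> ^ ?n"
  have "(\<Sum>P\<in>?PS. real (maximal_function rep f P) ^ ?n / fact ?n) \<le>
      real (card ?PS) * (\<Sum>x\<in>UNIV. real ((1 + l) * f x) ^ ?n / fact ?n)"
  proof (rule LIMSEQ_le)
    show "(\<lambda>\<mu>. \<Sum>P\<in>?PS. ?S (maximal_function rep f P) \<mu>) \<longlonglongrightarrow>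
        (\<Sum>P\<in>?PS. real (maximal_function rep f P) ^ ?n / fact ?n)"
      by (intro tendsto_sum simplex_count_asymptotics)
    show "(\<lambda>\<mu>. real (card ?PS) * (\<Sum>x\<in>UNIV. ?S ((1 + l) * f x) \<mu>)) \<longlonglongrightarrow>
        real (card ?PS) * (\<Sum>x\<in>UNIV. real ((1 + l) * f x) ^ ?n / fact ?n)"
      by (intro tendsto_mult tendsto_const tendsto_sum simplex_count_asymptotics)
    have "(\<Sum>P\<in>?PS. ?S (maximal_function rep f P) \<mu>) \<le> real (card ?PS) * (\<Sum>x\<in>UNIV. ?S ((1 + l) * f x) \<mu>)" for \<mu>
    proof -
      have "real (\<Sum>P\<in>?PS. simplex_count TYPE('n) (\<mu> * maximal_function rep f P)) \<le>
          real (card ?PS * (\<Sum>x\<in>UNIV. simplex_count TYPE('n) ((1 + l) * \<mu> * f x)))"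
        by (subst of_nat_le_iff) (rule sum_simplex_count_maximal_function_le[OF p k q rep w wl])
      then have "real (\<Sum>P\<in>?PS. simplex_count TYPE('n) (\<mu> * maximal_function rep f P)) / real \<mu> ^ ?n \<le>
          real (card ?PS * (\<Sum>x\<in>UNIV. simplex_count TYPE('n) ((1 + l) * \<mu> * f x))) / real \<mu> ^ ?n"
        by (rule divide_right_mono) simp
      then show ?thesis
        by (simp only: of_nat_sum of_nat_mult sum_divide_distrib times_divide_eq_right[symmetric]
              mult.left_commute[of \<mu>] mult.assoc)
    qed
    then show "\<exists>N. \<forall>\<mu>\<ge>N. (\<Sum>P\<in>?PS. ?S (maximal_function rep f P) \<mu>) \<le>
        real (card ?PS) * (\<Sum>x\<in>UNIV. ?S ((1 + l) * f x) \<mu>)" by blast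
  qed
  moreover have "real ((1 + l) * f x) ^ ?n = (1 + real l) ^ ?n * real (f x) ^ ?n" for x
    by (simp only: of_nat_mult of_nat_add of_nat_1 power_mult_distrib)
  then have "real (card ?PS) * (\<Sum>x\<in>UNIV. real ((1 + l) * f x) ^ ?n / fact ?n) =
      (real (card ?PS) * (1 + real l) ^ ?n * (\<Sum>x\<in>UNIV. real (f x) ^ ?n)) / fact ?n"
    by (simp only: sum_divide_distrib[symmetric] sum_distrib_left[symmetric] times_divide_eq_right mult.assoc)
  ultimately have "(\<Sum>P\<in>?PS. real (maximal_function rep f P) ^ ?n) / fact ?n \<le>
      (real (card ?PS) * (1 + real l) ^ ?n * (\<Sum>x\<in>UNIV. real (f x) ^ ?n)) / fact ?n"
    by (simp only: sum_divide_distrib[symmetric])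
  then show ?thesis by (simp add: divide_le_cancel)
qed

section \<open>Comparison with the two stated constants\<close>

theorem theorem1p6:
  fixes n p k w :: nat
    and f :: "'a::nontriv mod_ring ^ 'n \<Rightarrow> nat"
    and rep :: "('a mod_ring ^ 'n) set \<Rightarrow> 'a mod_ring ^ 'n"
  assumes "n \<ge> 1" and "CARD('n) = n"
    and "prime p" and "k \<ge> 1" and "CARD('a) = p ^ k"
    and "proj_representatives rep"
    and "\<exists>x. f x \<noteq> 0"
    and "w = (MAX u\<in>proj_space. maximal_function rep f u)"
  shows "((w, n) \<noteq> (1, 1) \<longrightarrow>
           (\<Sum>x\<in>UNIV. real (f x) ^ n) \<ge>
             (1 / (2 * real_of_int \<lceil>log (real p) (real w) + log (real p) (real n)\<rceil>) ^ n)
               / real (card (proj_space :: ('a mod_ring ^ 'n) set set))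
             * (\<Sum>u\<in>proj_space. real (maximal_function rep f u) ^ n))
       \<and> (p > n \<longrightarrow>
           (\<Sum>x\<in>UNIV. real (f x) ^ n) \<ge>
             ((real_of_int \<lceil>log (real p) (real w)\<rceil> + 1) powi (- int n)
                 * (1 + real n / real p) powi (- int n))
               / real (card (proj_space :: ('a mod_ring ^ 'n) set set))
             * (\<Sum>u\<in>proj_space. real (maximal_function rep f u) ^ n))"
proof -
  let ?PS = "proj_space :: ('a mod_ring ^ 'n) set set"
  let ?S = "\<Sum>u\<in>?PS. real (maximal_function rep f u) ^ n"
  let ?T = "\<Sum>x\<in>UNIV. real (f x) ^ n"
  note p = assms(3)
  have p1: "real p > 1" using prime_gt_1_nat[OF p] by simp
  have wmax: "maximal_function rep f P \<le> w" if "P \<in> ?PS" for P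
    unfolding assms(8) using that by (intro Max_ge) auto
  have "(\<chi> i. 1) \<in> (unimodular_vectors :: ('a mod_ring ^ 'n) set)" by (simp add: unimodular_vectors_def)
  then have "unit_multiple_rel `` {\<chi> i. 1} \<in> ?PS" unfolding proj_space_def by (rule quotientI)
  then obtain P where P: "P \<in> ?PS" by blast
  have card: "card ?PS > 0" using P by (auto simp: card_gt_0_iff)
  have w1: "w \<ge> 1"
  proof -
    obtain x where x: "f x \<noteq> 0" using assms(7) by blast
    have "1 \<le> f (x + 0 *s rep P)" using x by simp
    also have "\<dots> \<le> (\<Sum>t\<in>UNIV. f (x + t *s rep P))" by (rule member_le_sum) auto
    also have "\<dots> \<le> maximal_function rep f P"
      unfolding maximal_function_def by (rule cSup_upper) auto
    also have "\<dots> \<le> w" by (rule wmax[OF P])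
    finally show ?thesis .
  qed
  define L where "L = \<lceil>log (real p) (real w)\<rceil>"
  have log0: "log (real p) (real w) \<ge> 0" using p1 w1 by simp
  then have L0: "L \<ge> 0" by (simp add: L_def)
  have "w \<le> p ^ nat L"
  proof -
    have "real w = real p powr log (real p) (real w)" using p1 w1 by simp
    also have "\<dots> \<le> real p powr real (nat L)"
      using p1 L0 by (intro powr_mono) (auto simp: L_def le_of_int_ceiling)
    also have "\<dots> = real (p ^ nat L)" using p1 by (simp add: powr_realpow)
    finally show ?thesis by simp
  qed
  from sum_maximal_function_power_le[OF p assms(4,5,6) wmax disjI1[OF this]]
  have main: "?S \<le> real (card ?PS) * (1 + real_of_int L) ^ n * ?T"
    unfolding assms(2) using L0 by simp
  have T0: "?T \<ge> 0" by (auto intro: sum_nonneg)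
  have bound: "1 / D / real (card ?PS) * ?S \<le> ?T" if D: "D \<ge> (1 + real_of_int L) ^ n" for D
  proof -
    have "0 < (1 + real_of_int L) ^ n" using L0 by simp
    then have D0: "D > 0" using D by linarith
    have "?S \<le> real (card ?PS) * D * ?T"
      by (rule order.trans[OF main]) (intro mult_right_mono mult_left_mono D T0, simp)
    then show ?thesis using D0 card by (simp add: field_simps)
  qed
  show ?thesis
  proof (intro conjI impI)
    assume wn: "(w, n) \<noteq> (1, 1)"
    define c where "c = \<lceil>log (real p) (real w) + log (real p) (real n)\<rceil>"
    have logn: "log (real p) (real n) \<ge> 0" using p1 assms(1) by simp
    have "L \<le> c" unfolding L_def c_def using logn by (intro ceiling_mono) simp
    \<comment> \<open>Excluding \<open>w = n = 1\<close> makes one of the logarithms positive. With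
      \<open>L \<le> c\<close> this yields \<open>1 + L \<le> 2 * c\<close>, which is where the
      factor \<open>2\<close> is used.\<close>
    moreover have "c \<ge> 1"
    proof -
      have "log (real p) (real w) > 0 \<or> log (real p) (real n) > 0"
        using wn w1 assms(1) p1 by (cases "w = 1") auto
      then have "log (real p) (real w) + log (real p) (real n) > 0" using log0 logn by linarith
      then show ?thesis by (simp add: c_def one_le_ceiling)
    qed
    ultimately have "1 + L \<le> 2 * c" by linarith
    then have "1 + real_of_int L \<le> 2 * real_of_int c" by linarith
    then have "(1 + real_of_int L) ^ n \<le> (2 * real_of_int c) ^ n" using L0 by (intro power_mono) auto
    then show "1 / (2 * real_of_int \<lceil>log (real p) (real w) + log (real p) (real n)\<rceil>) ^ n
        / real (card ?PS) * ?S \<le> ?T"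
      unfolding c_def by (rule bound)
  next
    assume "p > n"
    let ?e = "1 + real n / real p"
    \<comment> \<open>The factor \<open>?e\<close> is at least \<open>1\<close>, so it only enlarges
      the denominator.\<close>
    have "(1 + real_of_int L) ^ n * 1 \<le> (real_of_int L + 1) ^ n * ?e ^ n"
      using L0 p1 by (intro mult_mono one_le_power) (auto simp: add.commute)
    then have "1 / ((real_of_int L + 1) ^ n * ?e ^ n) / real (card ?PS) * ?S \<le> ?T"
      by (intro bound) simp
    moreover have "x powi (- int n) = 1 / x ^ n" for x :: real
      by (simp add: power_int_minus inverse_eq_divide)
    ultimately show "(real_of_int \<lceil>log (real p) (real w)\<rceil> + 1) powi (- int n) * ?e powi (- int n)
        / real (card ?PS) * ?S \<le> ?T"
      by (simp only: L_def times_divide_times_eq mult_1)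
  qed
qed

end
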